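(* Let $\psi_1,\psi_2$ be essentially bounded functions on $[0,1]$ and $\eta\in\mathbb R$. If $q=(q_1,q_2)$ is an extreme point of the convex set $$\Big\{q:\ q_1\preceq\hat q_2;\ q_1,q_2:[0,1]\to[0,1]\text{ nondecreasing, left-continuous};\ \int_0^1 q_1(x_1)\psi_1(x_1)\,dx_1+\int_0^1q_2(x_2)\psi_2(x_2)\,dx_2\le\eta\Big\},$$ then there exist $\underline z\le\overline z$ in $[0,1]$, numbers $\underline\gamma,\overline\gamma$ with $q_1(\underline z)\le\underline\gamma\le\overline\gamma\le q_1(\overline z^{+})$, and $\lambda\in(0,1)$ such that $q_1(z)=\hat q_2(z)$ for all $z\in[0,1]\setminus(\underline z,\overline z]$, and for $z\in(\underline z,\overline z]$, $$q_1(z)=\lambda\overline\gamma+(1-\lambda)\underline\gamma,\qquad \hat q_2(z)=\begin{cases}\underline\gamma,& z\in(\underline z,\ (1-\lambda)\overline z+\lambda\underline z],\\ \overline\gamma,& z\in((1-\lambda)\overline z+\lambda\underline z,\ \overline z].\end{cases}$$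
   Context: For nondecreasing $g_1,g_2:[0,1]\to\mathbb R$, $g_1\preceq g_2$ ($g_2$ majorizes $g_1$) means $\int_x^1 g_1(z)\,dz\le\int_x^1 g_2(z)\,dz$ for all $x\in[0,1]$ with equality at $x=0$. For a nondecreasing left-continuous $g:[0,1]\to[0,1]$, $g^{-1}(z):=\inf\{x\in[0,1]:g(x)>z\}$ (with $\inf\emptyset=1$), and the conjugate of $g$ is $\hat g(z):=1-g^{-1}(1-z)$, which is left-continuous. $g(z^+)$ denotes the right limit. Functions equal almost everywhere are identified; thus the value of $q_i$ at $0$ is immaterial and is read as $q_i(0)=0$, and by convention $q_1(1^+)=1$. *)

theory Defs
  imports "HOL-Analysis.Analysis" "HOL-Library.Function_Algebras"
begin

text \<open>Functions form a real vector space pointwise; this makes the library notion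
  \<^const>\<open>extreme_point_of\<close> available for pairs of functions.\<close>

instantiation "fun" :: (type, real_vector) real_vector
begin

definition "scaleR c f = (\<lambda>x. c *\<^sub>R f x)"

instance
  by standard (simp_all add: scaleR_fun_def plus_fun_def fun_eq_iff
      scaleR_add_right scaleR_add_left)

end

definition majorized_by :: "(real \<Rightarrow> real) \<Rightarrow> (real \<Rightarrow> real) \<Rightarrow> bool"  (infix \<open>\<preceq>\<close> 50)
  where "g1 \<preceq> g2 \<longleftrightarrow>
    (\<forall>x\<in>{0..1}. set_lebesgue_integral lebesgue {x..1} g1 \<le> set_lebesgue_integral lebesgue {x..1} g2) \<and>
    set_lebesgue_integral lebesgue {0..1} g1 = set_lebesgue_integral lebesgue {0..1} g2"

definition gen_inverse :: "(real \<Rightarrow> real) \<Rightarrow> real \<Rightarrow> real"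
  where "gen_inverse g z =
    (if {x \<in> {0..1}. g x > z} = {} then 1 else Inf {x \<in> {0..1}. g x > z})"

definition conjugate :: "(real \<Rightarrow> real) \<Rightarrow> real \<Rightarrow> real"
  where "conjugate g z = 1 - gen_inverse g (1 - z)"

text \<open>The nondecreasing left-continuous functions from the unit interval to itself, modulo almost
  everywhere equality. Such a function is determined almost everywhere by its values on
  \<^term>\<open>{0<..1::real}\<close>, so each class is represented by its unique left-continuous
  member with value 0 at 0. Requiring the value 0 outside the unit interval as well turns
  almost everywhere equality into plain equality of functions on the reals, and it is preserved by
  convex combinations.\<close>

definition lc_nondecreasing :: "(real \<Rightarrow> real) set"
  where "lc_nondecreasing = {g. g \<in> {0..1} \<rightarrow> {0..1} \<and> mono_on {0..1} g \<and>
    (\<forall>x\<in>{0<..1}. continuous (at_left x) g) \<and>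
    g 0 = 0 \<and> (\<forall>x. x \<notin> {0..1} \<longrightarrow> g x = 0)}"

definition essentially_bounded :: "(real \<Rightarrow> real) \<Rightarrow> bool"
  where "essentially_bounded f \<longleftrightarrow> f \<in> borel_measurable (lebesgue_on {0..1}) \<and>
    (\<exists>C. AE x in lebesgue_on {0..1}. \<bar>f x\<bar> \<le> C)"

definition feasible_set ::
    "(real \<Rightarrow> real) \<Rightarrow> (real \<Rightarrow> real) \<Rightarrow> real \<Rightarrow> ((real \<Rightarrow> real) \<times> (real \<Rightarrow> real)) set"
  where "feasible_set \<psi>1 \<psi>2 \<eta> = {(q1, q2).
    q1 \<preceq> conjugate q2 \<and> q1 \<in> lc_nondecreasing \<and> q2 \<in> lc_nondecreasing \<and>
    set_lebesgue_integral lebesgue {0..1} (\<lambda>x. q1 x * \<psi>1 x) +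
    set_lebesgue_integral lebesgue {0..1} (\<lambda>x. q2 x * \<psi>2 x) \<le> \<eta>}"

text \<open>The right limit of a function on the unit interval, with the convention that it is 1 at 1.\<close>

definition right_limit :: "(real \<Rightarrow> real) \<Rightarrow> real \<Rightarrow> real"
  where "right_limit g z = (if z = 1 then 1 else Lim (at_right z) g)"

end

theory Submission
  imports Defs
begin

text \<open>
  By Fubini, \<^term>\<open>q1 \<preceq> conjugate q2\<close> says that \<open>q1\<close> and \<open>q2\<close> have the same integral and that
  \<open>slack x y = (1 - x) * (1 - y) + \<integral>\<^sub>0\<^sup>y q2 - \<integral>\<^sub>x\<^sup>1 q1\<close> is nonnegative on the unit square; this form is
  affine in the pair and symmetric in \<open>q1\<close> and \<open>q2\<close>. Perturbations of the form
  \<open>(h \<circ> q1, k \<circ> q2)\<close> with \<open>h\<close> and \<open>k\<close> Lipschitz and vanishing at 0 and 1 keep both functions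
  monotone, and they keep the pair feasible in both directions if the induced change of the slack is
  dominated by the slack. Since there is only one linear constraint, at an extreme point any
  two such perturbations are linearly dependent.

  The zeros of the slack form a closed antitone chain from (0, 1) to (1, 0), and
  \<open>q1 = conjugate q2\<close> wherever the chain projects. Each gap of the chain, with corners (a, d) and
  (b, c), carries a perturbation of \<open>q1\<close> alone if \<open>q1\<close> is not constant on (a, b), one of \<open>q2\<close>
  alone if \<open>q2\<close> is not constant on (c, d), and one changing the total mass if one of the two is
  constant. Hence there is at most one gap, and both functions are constant on it.
\<close>

section \<open>Left-continuous nondecreasing functions\<close>

lemma lc_range: "q \<in> lc_nondecreasing \<Longrightarrow> 0 \<le> q x \<and> q x \<le> 1"
  by (cases "x \<in> {0..1}") (auto simp: lc_nondecreasing_def Pi_iff)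

lemma lc_mono: "q \<in> lc_nondecreasing \<Longrightarrow> 0 \<le> x \<Longrightarrow> x \<le> y \<Longrightarrow> y \<le> 1 \<Longrightarrow> q x \<le> q y"
  by (auto simp: lc_nondecreasing_def mono_on_def)

lemma lc_0: "q \<in> lc_nondecreasing \<Longrightarrow> q 0 = 0"
  by (simp add: lc_nondecreasing_def)

lemma lc_outside: "q \<in> lc_nondecreasing \<Longrightarrow> x \<notin> {0..1} \<Longrightarrow> q x = 0"
  by (simp add: lc_nondecreasing_def)

lemma lc_tendsto:
  "q \<in> lc_nondecreasing \<Longrightarrow> 0 < x \<Longrightarrow> x \<le> 1 \<Longrightarrow> (q \<longlongrightarrow> q x) (at_left x)"
  by (auto simp: lc_nondecreasing_def continuous_within)

text \<open>By left continuity \<open>q x\<close> is the limit of the values just below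
  \<open>x\<close>, so a bound on an interval ending at \<open>x\<close> passes to
  \<open>x\<close>.\<close>

lemma lc_leI:
  assumes "q \<in> lc_nondecreasing" "0 \<le> u" "u < x" "x \<le> 1" "\<And>t. u < t \<Longrightarrow> t < x \<Longrightarrow> q t \<le> s"
  shows "q x \<le> s"
proof (rule tendsto_upperbound)
  show "(q \<longlongrightarrow> q x) (at_left x)"
    using assms lc_tendsto by simp
  show "\<forall>\<^sub>F t in at_left x. q t \<le> s"
    using eventually_at_left[of u x] assms by blast
qed auto

text \<open>Left continuity bounds \<open>q x\<close> from above, monotonicity from below. This
  extends constancy from an open gap to its right end.\<close>

lemma lc_const_right:
  assumes q: "q \<in> lc_nondecreasing" and "0 \<le> u" "u < x" "x \<le> 1" and const: "\<And>t. u < t \<Longrightarrow> t < x \<Longrightarrow> q t = w"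
  shows "q x = w"
proof (rule antisym)
  show "q x \<le> w"
    using const by (intro lc_leI[OF q assms(2-4)]) simp
  have "q ((u + x) / 2) \<le> q x"
    using assms by (intro lc_mono[OF q]) auto
  then show "w \<le> q x"
    using const[of "(u + x) / 2"] assms by simp
qed

lemma lc_measurable:
  assumes "q \<in> lc_nondecreasing"
  shows "q \<in> borel_measurable borel"
proof -
  have "q \<in> borel_measurable (restrict_space borel {0..1})"
    using assms by (intro borel_measurable_mono_on_fnc) (simp add: lc_nondecreasing_def)
  then have "(\<lambda>x. indicator {0..1} x *\<^sub>R q x) \<in> borel_measurable borel"
    by (subst (asm) borel_measurable_restrict_space_iff) auto
  also have "(\<lambda>x. indicator {0..1} x *\<^sub>R q x) = q"
    using lc_outside[OF assms] by (auto simp: indicator_def fun_eq_iff)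
  finally show ?thesis .
qed

lemma lc_comp:
  assumes "q \<in> lc_nondecreasing" "mono f" "continuous_on UNIV f" "f 0 = 0" "f 1 = 1"
  shows "(\<lambda>x. f (q x)) \<in> lc_nondecreasing"
proof -
  have "0 \<le> f (q x)" "f (q x) \<le> 1" for x
    using monoD[OF assms(2), of 0 "q x"] monoD[OF assms(2), of "q x" 1] lc_range[OF assms(1)] assms
    by auto
  moreover have "continuous (at_left x) (\<lambda>x. f (q x))" if "x \<in> {0<..1}" for x
    using that assms(1,3) lc_tendsto[OF assms(1)]
    by (auto simp: continuous_within intro!: continuous_on_tendsto_compose[OF assms(3)])
  ultimately show ?thesis
    using assms lc_mono[OF assms(1)] lc_0[OF assms(1)] lc_outside[OF assms(1)]
    unfolding lc_nondecreasing_def by (auto simp: mono_on_def dest: monoD)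
qed

lemma lc_comp_set_integrable:
  fixes h :: "real \<Rightarrow> real"
  assumes "q \<in> lc_nondecreasing" "continuous_on UNIV h"
  shows "set_integrable lborel {s..t} (\<lambda>x. h (q x))"
proof -
  have "compact (h ` {0..1::real})"
    using assms(2) by (intro compact_continuous_image) (auto intro: continuous_on_subset)
  then obtain B where "\<forall>v \<in> {0..1}. norm (h v) \<le> (B::real)"
    by (meson bounded_iff compact_imp_bounded imageI)
  then have "norm (h (q x)) \<le> B" for x
    using lc_range[OF assms(1)] by simp
  moreover have "(\<lambda>x. h (q x)) \<in> borel_measurable lborel"
    using measurable_compose[OF lc_measurable[OF assms(1)] borel_measurable_continuous_onI[OF assms(2)]]
    by simp
  ultimately show ?thesis
    unfolding set_integrable_def
    by (intro integrableI_bounded_set_indicator) (auto simp: emeasure_lborel_Icc_eq)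
qed

lemma lc_comp_integrable:
  fixes h :: "real \<Rightarrow> real"
  assumes "q \<in> lc_nondecreasing" "continuous_on UNIV h"
  shows "(\<lambda>x. h (q x)) integrable_on {s..t}"
  using set_borel_integral_eq_integral(1)[OF lc_comp_set_integrable[OF assms]] .

lemma lc_integrable: "q \<in> lc_nondecreasing \<Longrightarrow> q integrable_on {s..t}"
  using lc_comp_integrable[of q "\<lambda>x. x"] by simp

text \<open>Translates the Lebesgue integrals of the definitions into the gauge integrals used
  throughout; \<open>q\<close> is Borel measurable, so completing the measure changes
  nothing.\<close>

lemma lc_set_integral:
  assumes "q \<in> lc_nondecreasing"
  shows "set_lebesgue_integral lebesgue {s..t} q = integral {s..t} q"
proof -
  have [measurable]: "q \<in> borel_measurable borel"
    using lc_measurable[OF assms] .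
  have "set_lebesgue_integral lebesgue {s..t} q = set_lebesgue_integral lborel {s..t} q"
    unfolding set_lebesgue_integral_def by (rule integral_completion) measurable
  also have "\<dots> = integral {s..t} q"
    using set_borel_integral_eq_integral(2)[OF lc_comp_set_integrable[OF assms, of "\<lambda>x. x"]] by simp
  finally show ?thesis .
qed

section \<open>Integral estimates from hypotheses on open intervals\<close>

lemma integral_le_interior:
  fixes f g :: "real \<Rightarrow> real"
  assumes "f integrable_on {s..t}" "g integrable_on {s..t}" "\<And>x. s < x \<Longrightarrow> x < t \<Longrightarrow> f x \<le> g x"
  shows "integral {s..t} f \<le> integral {s..t} g"
proof -
  have "integral {s..t} f = integral {s<..<t} f" "integral {s..t} g = integral {s<..<t} g"
    using integral_open_interval_real by metis+
  moreover have "f integrable_on {s<..<t}" "g integrable_on {s<..<t}"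
    using assms by (simp_all add: integrable_on_open_interval_real)
  ultimately show ?thesis
    using assms(3) by (auto intro!: integral_le)
qed

lemma integral_le_const:
  fixes f :: "real \<Rightarrow> real"
  assumes "f integrable_on {s..t}" "s \<le> t" "\<And>x. s < x \<Longrightarrow> x < t \<Longrightarrow> f x \<le> K"
  shows "integral {s..t} f \<le> (t - s) * K"
  using integral_le_interior[OF assms(1) integrable_const_ivl[of K s t]] assms(2,3) by (simp add: mult.commute)

lemma integral_ge_const:
  fixes f :: "real \<Rightarrow> real"
  assumes "f integrable_on {s..t}" "s \<le> t" "\<And>x. s < x \<Longrightarrow> x < t \<Longrightarrow> K \<le> f x"
  shows "(t - s) * K \<le> integral {s..t} f"
  using integral_le_interior[OF integrable_const_ivl[of K s t] assms(1)] assms(2,3) by (simp add: mult.commute)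

lemma integral_eq_const:
  fixes f :: "real \<Rightarrow> real"
  assumes "f integrable_on {s..t}" "s \<le> t" "\<And>x. s < x \<Longrightarrow> x < t \<Longrightarrow> f x = K"
  shows "integral {s..t} f = (t - s) * K"
  using integral_le_const[OF assms(1,2), of K] integral_ge_const[OF assms(1,2), of K] assms(3) by force

text \<open>By left continuity \<open>h (q t)\<close> stays above half its value at \<open>x\<close>
  on an interval to the left of \<open>x\<close>. This makes the masses of the perturbations
  positive.\<close>

lemma lc_comp_integral_pos:
  fixes h :: "real \<Rightarrow> real"
  assumes q: "q \<in> lc_nondecreasing" and h: "continuous_on UNIV h" "\<And>v. 0 \<le> h v"
    and x: "0 < x" "x \<le> 1" "0 < h (q x)"
  shows "0 < integral {0..1} (\<lambda>x. h (q x))"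
proof -
  have "((\<lambda>t. h (q t)) \<longlongrightarrow> h (q x)) (at_left x)"
    using lc_tendsto[OF q x(1,2)] by (rule continuous_on_tendsto_compose[OF h(1)]) auto
  moreover have "h (q x) / 2 < h (q x)"
    using x by simp
  ultimately have "\<forall>\<^sub>F t in at_left x. h (q x) / 2 < h (q t)"
    by (rule order_tendstoD)
  then obtain u where u: "u < x" "\<And>t. u < t \<Longrightarrow> t < x \<Longrightarrow> h (q x) / 2 < h (q t)"
    unfolding eventually_at_left[OF \<open>0 < x\<close>] by (metis)
  define w where "w = max u 0"
  have w: "0 \<le> w" "w < x" "\<And>t. w < t \<Longrightarrow> t < x \<Longrightarrow> h (q x) / 2 < h (q t)"
    using u x by (auto simp: w_def)
  have I: "(\<lambda>x. h (q x)) integrable_on {s..t}" for s t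
    using lc_comp_integrable q h by blast
  have "0 < (x - w) * (h (q x) / 2)"
    using w x by simp
  also have "\<dots> \<le> integral {w..x} (\<lambda>x. h (q x))"
    using w by (intro integral_ge_const I) (auto simp: less_imp_le)
  also have "\<dots> \<le> integral {0..1} (\<lambda>x. h (q x))"
    using w x h by (intro integral_subset_le I) auto
  finally show ?thesis .
qed

section \<open>Sublevel sets and the values of the conjugate\<close>

text \<open>The sublevel set at \<open>s\<close> is a closed interval from 0: it contains 0 because
  \<open>q 0 = 0\<close>, and its supremum by left continuity.\<close>

lemma lc_threshold:
  assumes "q \<in> lc_nondecreasing" "0 \<le> s"
  obtains y where "0 \<le> y" "y \<le> 1" "\<And>t. 0 \<le> t \<Longrightarrow> t \<le> y \<Longrightarrow> q t \<le> s"
    "\<And>t. y < t \<Longrightarrow> t \<le> 1 \<Longrightarrow> s < q t"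
proof -
  define S where "S = {t \<in> {0..1}. q t \<le> s}"
  have 0: "0 \<in> S" and bdd: "bdd_above S"
    using assms lc_0[OF assms(1)] by (auto simp: S_def)
  have "Sup S \<le> 1"
    using 0 by (auto simp: S_def intro!: cSup_least)
  then have y: "0 \<le> Sup S" "Sup S \<le> 1"
    using cSup_upper[OF 0 bdd] by simp_all
  have below: "q t \<le> s" if t: "0 \<le> t" "t < Sup S" for t
  proof -
    obtain r where "r \<in> S" "t < r"
      using less_cSup_iff[of S t] 0 bdd t(2) by blast
    then show ?thesis
      using lc_mono[OF assms(1), of t r] t by (auto simp: S_def)
  qed
  have "q (Sup S) \<le> s"
  proof (cases "Sup S = 0")
    case True
    then show ?thesis using assms lc_0[OF assms(1)] by simp
  next
    case False
    then have "0 < Sup S"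
      using y by simp
    then show ?thesis
      by (rule lc_leI[OF assms(1) order_refl]) (simp_all add: y below)
  qed
  moreover have "s < q t" if "Sup S < t" "t \<le> 1" for t
  proof (rule ccontr)
    assume "\<not> s < q t"
    then have "t \<in> S"
      using that y by (simp add: S_def)
    then show False
      using cSup_upper[OF _ bdd, of t] that by simp
  qed
  ultimately show ?thesis
    using that[OF y] below by (metis order.order_iff_strict)
qed

text \<open>The generalized inverse at level \<open>1 - z\<close> is the right end \<open>y\<close>
  of the sublevel set. If \<open>y = 1\<close>, the strict superlevel set is empty and the default
  value 1 fits the same formula.\<close>

lemma conjugate_threshold:
  assumes "q \<in> lc_nondecreasing" "0 \<le> y" "y \<le> 1" "z \<le> 1"
    and "\<And>t. 0 \<le> t \<Longrightarrow> t \<le> y \<Longrightarrow> q t \<le> 1 - z" "\<And>t. y < t \<Longrightarrow> t \<le> 1 \<Longrightarrow> 1 - z < q t"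
  shows "conjugate q z = 1 - y"
proof -
  have "{x \<in> {0..1}. 1 - z < q x} = {y<..1}"
    using assms by (force simp: not_le)
  then show ?thesis
    using assms(2,3) by (auto simp: conjugate_def gen_inverse_def)
qed

lemma conjugate_0:
  assumes "q \<in> lc_nondecreasing"
  shows "conjugate q 0 = 0"
proof -
  have "conjugate q 0 = 1 - 1"
    using lc_range[OF assms] by (intro conjugate_threshold[OF assms]) auto
  then show ?thesis
    by simp
qed

text \<open>The right limit is the infimum of \<open>q\<close> over the points after
  \<open>z\<close>. The bound \<open>s \<le> 1\<close> settles \<open>z = 1\<close>, where the right
  limit is 1 by convention.\<close>

lemma right_limit_ge:
  assumes q: "q \<in> lc_nondecreasing" and z: "0 \<le> z" "z \<le> 1" and s: "s \<le> 1" "\<And>t. z < t \<Longrightarrow> t \<le> 1 \<Longrightarrow> s \<le> q t"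
  shows "s \<le> right_limit q z"
proof (cases "z = 1")
  case True
  then show ?thesis using s by (simp add: right_limit_def)
next
  case False
  then have z1: "z < 1" using z by simp
  define l where "l = Inf (q ` {z<..1})"
  have bdd: "bdd_below (q ` {z<..1})" and ne: "q ` {z<..1} \<noteq> {}"
    using lc_range[OF q] z1 by (auto intro!: bdd_belowI)
  have "(q \<longlongrightarrow> l) (at_right z)"
  proof (rule order_tendstoI)
    fix u assume "u < l"
    then have "u < q t" if "z < t" "t \<le> 1" for t
      using cInf_lower[OF _ bdd, of "q t"] that by (force simp: l_def)
    then show "\<forall>\<^sub>F t in at_right z. u < q t"
      using z1 by (auto simp: eventually_at_right[of z 1] intro!: exI[of _ 1])
  next
    fix u assume "l < u"
    then obtain t where t: "z < t" "t \<le> 1" "q t < u"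
      using cInf_less_iff[OF ne bdd, of u] by (auto simp: l_def)
    then have "q t' < u" if "z < t'" "t' < t" for t'
      using lc_mono[OF q, of t' t] that z by simp
    then show "\<forall>\<^sub>F t in at_right z. q t < u"
      using t z1 by (auto simp: eventually_at_right[of z 1] intro!: exI[of _ t])
  qed
  then have "Lim (at_right z) q = l"
    by (intro tendsto_Lim) auto
  moreover have "s \<le> l"
    unfolding l_def using ne s by (intro cInf_greatest) auto
  ultimately show ?thesis
    using False by (simp add: right_limit_def)
qed

section \<open>Majorization by a conjugate\<close>

text \<open>Both sides are the area of the region \<open>x \<le> z \<le> 1\<close>, \<open>1 - z < q t\<close>, sliced along either axis.\<close>

lemma conjugate_integral:
  assumes q: "q \<in> lc_nondecreasing" and x: "0 \<le> x" "x \<le> 1"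
  shows "set_lebesgue_integral lebesgue {x..1} (conjugate q) = integral {0..1} (\<lambda>t. min (1 - x) (q t))"
proof -
  have [measurable]: "q \<in> borel_measurable borel"
    using lc_measurable[OF q] .
  define T where "T = {p \<in> space (lborel \<Otimes>\<^sub>M lborel).
    x \<le> fst p \<and> fst p \<le> 1 \<and> 0 \<le> snd p \<and> snd p \<le> 1 \<and> 1 - fst p < q (snd p)}"
  have T: "T \<in> sets (lborel \<Otimes>\<^sub>M lborel)"
    unfolding T_def by measurable
  have T_iff: "(z, t) \<in> T \<longleftrightarrow> x \<le> z \<and> z \<le> 1 \<and> 0 \<le> t \<and> t \<le> 1 \<and> 1 - z < q t" for z t
    by (simp add: T_def space_pair_measure)
  \<comment> \<open>The slice at fixed \<open>z\<close> runs from the threshold of level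
    \<open>1 - z\<close> to 1, so its length is the conjugate.\<close>
  have section1: "0 \<le> indicator {x..1} z * conjugate q z \<and>
    emeasure lborel (Pair z -` T) = ennreal (indicator {x..1} z * conjugate q z)" for z
  proof (cases "z \<in> {x..1}")
    case True
    then have "0 \<le> 1 - z" "z \<le> 1" by auto
    obtain y where y: "0 \<le> y" "y \<le> 1" "\<And>t. 0 \<le> t \<Longrightarrow> t \<le> y \<Longrightarrow> q t \<le> 1 - z"
        "\<And>t. y < t \<Longrightarrow> t \<le> 1 \<Longrightarrow> 1 - z < q t"
      using lc_threshold[OF q \<open>0 \<le> 1 - z\<close>] by metis
    have "(z, t) \<in> T \<longleftrightarrow> t \<in> {y<..1}" for t
      using True y(1,2) y(3)[of t] y(4)[of t] by (cases "t \<le> y") (auto simp: T_iff)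
    then have "Pair z -` T = {y<..1}"
      by (intro set_eqI) (simp only: vimage_eq)
    moreover have "conjugate q z = 1 - y"
      by (rule conjugate_threshold[OF q y(1,2) \<open>z \<le> 1\<close> y(3,4)])
    ultimately show ?thesis
      using True y by simp
  next
    case False
    then have "Pair z -` T = {}"
      by (intro set_eqI) (auto simp: vimage_eq T_iff)
    then show ?thesis
      using False by simp
  qed
  \<comment> \<open>The slice at fixed \<open>t\<close> ends at 1 and starts at the larger of
    \<open>x\<close> and \<open>1 - q t\<close>.\<close>
  have section2: "emeasure lborel ((\<lambda>z. (z, t)) -` T) = ennreal (indicator {0..1} t * min (1 - x) (q t))" for t
  proof (cases "t \<in> {0..1}")
    case True
    show ?thesis
    proof (cases "1 - x < q t")
      case c: True
      then have "(\<lambda>z. (z, t)) -` T = {x..1}"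
        using True by (intro set_eqI) (auto simp: vimage_eq T_iff)
      then show ?thesis
        using True c x by simp
    next
      case c: False
      then have "(\<lambda>z. (z, t)) -` T = {1 - q t<..1}"
        using True by (intro set_eqI) (auto simp: vimage_eq T_iff)
      then show ?thesis
        using True c x lc_range[OF q, of t] by simp
    qed
  next
    case False
    then have "(\<lambda>z. (z, t)) -` T = {}"
      by (intro set_eqI) (auto simp: vimage_eq T_iff)
    then show ?thesis
      using False by simp
  qed
  \<comment> \<open>Measurability of the conjugate is read off from that of the slice
    lengths.\<close>
  have "(\<lambda>z. enn2real (emeasure lborel (Pair z -` T))) \<in> borel_measurable lborel"
    using lborel.measurable_emeasure_Pair[OF T] by measurable
  moreover have "enn2real (emeasure lborel (Pair z -` T)) = indicator {x..1} z * conjugate q z" for z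
    using section1[of z] by simp
  ultimately have meas: "(\<lambda>z. indicator {x..1} z * conjugate q z) \<in> borel_measurable lborel"
    by simp
  have "set_lebesgue_integral lebesgue {x..1} (conjugate q) = (LINT z|lborel. indicator {x..1} z * conjugate q z)"
    unfolding set_lebesgue_integral_def using integral_completion[OF meas] by simp
  also have "\<dots> = enn2real (\<integral>\<^sup>+z. ennreal (indicator {x..1} z * conjugate q z) \<partial>lborel)"
    using section1 meas by (intro integral_eq_nn_integral) auto
  also have "\<dots> = enn2real (emeasure (lborel \<Otimes>\<^sub>M lborel) T)"
    using section1 by (simp add: lborel.emeasure_pair_measure_alt[OF T])
  also have "\<dots> = enn2real (\<integral>\<^sup>+t. ennreal (indicator {0..1} t * min (1 - x) (q t)) \<partial>lborel)"
    using section2 by (simp add: lborel_pair.emeasure_pair_measure_alt2[OF T])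
  also have "\<dots> = (LINT t|lborel. indicator {0..1} t * min (1 - x) (q t))"
    using lc_range[OF q] x by (intro integral_eq_nn_integral[symmetric]) auto
  also have "\<dots> = integral {0..1} (\<lambda>t. min (1 - x) (q t))"
    using set_borel_integral_eq_integral(2)[OF lc_comp_set_integrable[OF q, of "\<lambda>v. min (1 - x) v" 0 1]]
    by (simp add: set_lebesgue_integral_def continuous_on_min)
  finally show ?thesis .
qed

text \<open>For fixed \<open>x\<close>, the minimum over \<open>y\<close> is the integral of
  \<open>conjugate q2 - q1\<close> over \<open>{x..1}\<close>. The extra variable \<open>y\<close>
  replaces the nonlinear conjugate by a family of affine conditions.\<close>

definition slack :: "(real \<Rightarrow> real) \<Rightarrow> (real \<Rightarrow> real) \<Rightarrow> real \<Rightarrow> real \<Rightarrow> real"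
  where "slack q1 q2 x y = (1 - x) * (1 - y) + integral {0..y} q2 - integral {x..1} q1"

locale feasible_pair =
  fixes q1 q2 :: "real \<Rightarrow> real"
  assumes lc1: "q1 \<in> lc_nondecreasing" and lc2: "q2 \<in> lc_nondecreasing"
    and mass: "integral {0..1} q1 = integral {0..1} q2"
    and slack_nonneg: "0 \<le> x \<Longrightarrow> x \<le> 1 \<Longrightarrow> 0 \<le> y \<Longrightarrow> y \<le> 1 \<Longrightarrow> 0 \<le> slack q1 q2 x y"

text \<open>Bound the minimum by \<open>q\<close> to the left of \<open>y\<close> and by
  \<open>1 - x\<close> to the right.\<close>

lemma min_integral_le:
  assumes q: "q \<in> lc_nondecreasing" and "0 \<le> x" "x \<le> 1" "0 \<le> y" "y \<le> 1"
  shows "integral {0..1} (\<lambda>t. min (1 - x) (q t)) \<le> (1 - x) * (1 - y) + integral {0..y} q"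
proof -
  have I: "(\<lambda>t. min (1 - x) (q t)) integrable_on {s..t}" for s t
    by (rule lc_comp_integrable[OF q, of "\<lambda>v. min (1 - x) v"]) (intro continuous_intros)
  have "integral {0..y} (\<lambda>t. min (1 - x) (q t)) \<le> integral {0..y} q"
    by (intro integral_le I lc_integrable[OF q]) auto
  moreover have "integral {y..1} (\<lambda>t. min (1 - x) (q t)) \<le> (1 - y) * (1 - x)"
    using assms by (intro integral_le_const I) auto
  moreover have "integral {0..1} (\<lambda>t. min (1 - x) (q t)) =
    integral {0..y} (\<lambda>t. min (1 - x) (q t)) + integral {y..1} (\<lambda>t. min (1 - x) (q t))"
    using assms by (intro Henstock_Kurzweil_Integration.integral_combine[symmetric] I) auto
  ultimately show ?thesis
    by (simp add: mult.commute)
qed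

text \<open>Both of these bounds are equalities when \<open>y\<close> is the threshold of level
  \<open>1 - x\<close>.\<close>

lemma min_integral_attained:
  assumes q: "q \<in> lc_nondecreasing" and x: "0 \<le> x" "x \<le> 1"
  obtains y where "0 \<le> y" "y \<le> 1"
    "integral {0..1} (\<lambda>t. min (1 - x) (q t)) = (1 - x) * (1 - y) + integral {0..y} q"
proof -
  have "0 \<le> 1 - x"
    using x by simp
  then obtain y where y: "0 \<le> y" "y \<le> 1" "\<And>t. 0 \<le> t \<Longrightarrow> t \<le> y \<Longrightarrow> q t \<le> 1 - x"
      "\<And>t. y < t \<Longrightarrow> t \<le> 1 \<Longrightarrow> 1 - x < q t"
    using lc_threshold[OF q] by metis
  have I: "(\<lambda>t. min (1 - x) (q t)) integrable_on {s..t}" for s t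
    by (rule lc_comp_integrable[OF q, of "\<lambda>v. min (1 - x) v"]) (intro continuous_intros)
  have "integral {0..y} (\<lambda>t. min (1 - x) (q t)) = integral {0..y} q"
    using y by (intro integral_cong) auto
  moreover have "integral {y..1} (\<lambda>t. min (1 - x) (q t)) = (1 - y) * (1 - x)"
    using y by (intro integral_eq_const I) (auto simp: min_def dest: less_imp_le)
  moreover have "integral {0..1} (\<lambda>t. min (1 - x) (q t)) =
    integral {0..y} (\<lambda>t. min (1 - x) (q t)) + integral {y..1} (\<lambda>t. min (1 - x) (q t))"
    using y by (intro Henstock_Kurzweil_Integration.integral_combine[symmetric] I) auto
  ultimately show ?thesis
    using that[OF y(1,2)] by (simp add: mult.commute)
qed

lemma feasible_pair_iff:
  assumes q: "q1 \<in> lc_nondecreasing" "q2 \<in> lc_nondecreasing"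
  shows "feasible_pair q1 q2 \<longleftrightarrow> q1 \<preceq> conjugate q2"
proof -
  \<comment> \<open>At \<open>x = 0\<close> the cap is 1 and has no effect, so the equality in
    majorization becomes equality of the masses.\<close>
  have "integral {0..1} (\<lambda>t. min (1 - 0) (q2 t)) = integral {0..1} q2"
    using lc_range[OF q(2)] by (intro integral_cong) (simp add: min_absorb2)
  then have maj: "q1 \<preceq> conjugate q2 \<longleftrightarrow> (\<forall>x\<in>{0..1}. integral {x..1} q1 \<le> integral {0..1} (\<lambda>t. min (1 - x) (q2 t)))
      \<and> integral {0..1} q1 = integral {0..1} q2"
    using q by (simp add: majorized_by_def lc_set_integral conjugate_integral)
  show ?thesis
  proof
    assume feasible: "feasible_pair q1 q2"
    have "integral {x..1} q1 \<le> integral {0..1} (\<lambda>t. min (1 - x) (q2 t))" if x: "0 \<le> x" "x \<le> 1" for x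
    proof -
      obtain y where "0 \<le> y" "y \<le> 1"
        "integral {0..1} (\<lambda>t. min (1 - x) (q2 t)) = (1 - x) * (1 - y) + integral {0..y} q2"
        using min_integral_attained[OF q(2) x] .
      then show ?thesis
        using feasible_pair.slack_nonneg[OF feasible x, of y] by (simp add: slack_def)
    qed
    then show "q1 \<preceq> conjugate q2"
      using maj feasible_pair.mass[OF feasible] by simp
  next
    assume "q1 \<preceq> conjugate q2"
    then have m: "integral {0..1} q1 = integral {0..1} q2"
      and le: "\<And>x. 0 \<le> x \<Longrightarrow> x \<le> 1 \<Longrightarrow> integral {x..1} q1 \<le> integral {0..1} (\<lambda>t. min (1 - x) (q2 t))"
      using maj by auto
    show "feasible_pair q1 q2"
    proof (unfold_locales, fact q(1), fact q(2), fact m)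
      fix x y :: real
      assume "0 \<le> x" "x \<le> 1" "0 \<le> y" "y \<le> 1"
      then show "0 \<le> slack q1 q2 x y"
        using le[of x] min_integral_le[OF q(2), of x y] by (simp add: slack_def)
    qed
  qed
qed

section \<open>Admissible perturbations\<close>

text \<open>A bump on the levels between \<open>p\<close> and \<open>r\<close>. With slopes 1 and -1
  it lies below the distance to either foot, which makes it comparable with the rates
  \<open>q1 t - (1 - y)\<close> at which the slack changes.\<close>

definition tent :: "real \<Rightarrow> real \<Rightarrow> real \<Rightarrow> real"
  where "tent p r v = max 0 (min (v - p) (r - v))"

lemma tent_nonneg: "0 \<le> tent p r v"
  by (simp add: tent_def)

lemma tent_pos: "p < v \<Longrightarrow> v < r \<Longrightarrow> 0 < tent p r v"
  by (simp add: tent_def)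

lemma tent_eq_0: "v \<le> p \<or> r \<le> v \<Longrightarrow> tent p r v = 0"
  by (auto simp: tent_def)

lemma tent_le1: "p \<le> v \<Longrightarrow> tent p r v \<le> v - p"
  by (auto simp: tent_def)

lemma tent_le2: "v \<le> r \<Longrightarrow> tent p r v \<le> r - v"
  by (auto simp: tent_def)

lemma tent_lipschitz: "1-lipschitz_on UNIV (tent p r)"
  by (rule lipschitz_onI) (auto simp: tent_def dist_real_def)

lemma tent_continuous: "continuous_on UNIV (tent p r)"
  using lipschitz_on_continuous_on[OF tent_lipschitz] .

text \<open>(a, d) and (b, c) are consecutive points of the antitone chain of zeros of the slack.\<close>

definition gap :: "(real \<Rightarrow> real) \<Rightarrow> (real \<Rightarrow> real) \<Rightarrow> real \<Rightarrow> real \<Rightarrow> real \<Rightarrow> real \<Rightarrow> bool"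
  where "gap q1 q2 a b c d \<longleftrightarrow> 0 \<le> a \<and> a < b \<and> b \<le> 1 \<and> 0 \<le> c \<and> c < d \<and> d \<le> 1 \<and>
    slack q1 q2 a d = 0 \<and> slack q1 q2 b c = 0 \<and>
    (\<forall>x\<in>{0..1}. \<forall>y\<in>{0..1}. slack q1 q2 x y = 0 \<longrightarrow> x \<le> a \<and> d \<le> y \<or> b \<le> x \<and> y \<le> c)"

text \<open>The functions act on values, so a flat piece of \<open>q1\<close> or \<open>q2\<close>
  stays flat. The Lipschitz bound preserves monotonicity for small multiples, the end values the
  range, the equal integrals the equality of masses, and the last condition the sign of the slack
  for multiples of either sign.\<close>

definition admissible ::
    "(real \<Rightarrow> real) \<Rightarrow> (real \<Rightarrow> real) \<Rightarrow> (real \<Rightarrow> real) \<Rightarrow> (real \<Rightarrow> real) \<Rightarrow> bool"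
  where "admissible q1 q2 h k \<longleftrightarrow>
    (\<exists>L. L-lipschitz_on UNIV h) \<and> (\<exists>L. L-lipschitz_on UNIV k) \<and>
    h 0 = 0 \<and> h 1 = 0 \<and> k 0 = 0 \<and> k 1 = 0 \<and>
    integral {0..1} (\<lambda>x. h (q1 x)) = integral {0..1} (\<lambda>x. k (q2 x)) \<and>
    (\<exists>C. \<forall>x\<in>{0..1}. \<forall>y\<in>{0..1}.
      \<bar>integral {0..y} (\<lambda>x. k (q2 x)) - integral {x..1} (\<lambda>x. h (q1 x))\<bar> \<le> C * slack q1 q2 x y)"

lemma admissibleI:
  assumes "L-lipschitz_on UNIV h" "L'-lipschitz_on UNIV k" "h 0 = 0" "h 1 = 0" "k 0 = 0" "k 1 = 0"
    and "integral {0..1} (\<lambda>x. h (q1 x)) = integral {0..1} (\<lambda>x. k (q2 x))"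
    and "\<And>x y. 0 \<le> x \<Longrightarrow> x \<le> 1 \<Longrightarrow> 0 \<le> y \<Longrightarrow> y \<le> 1 \<Longrightarrow>
      \<bar>integral {0..y} (\<lambda>x. k (q2 x)) - integral {x..1} (\<lambda>x. h (q1 x))\<bar> \<le> C * slack q1 q2 x y"
  shows "admissible q1 q2 h k"
  unfolding admissible_def
  by (intro conjI exI[of _ L] exI[of _ L'] exI[of _ C] ballI assms) (use assms in auto)

lemma lc_comp_lipschitz_integrable:
  fixes h :: "real \<Rightarrow> real"
  assumes "q \<in> lc_nondecreasing" "L-lipschitz_on UNIV h"
  shows "(\<lambda>x. h (q x)) integrable_on {s..t}"
  using lc_comp_integrable[OF assms(1) lipschitz_on_continuous_on[OF assms(2)]] .

lemma lc_comp_combine: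
  fixes h :: "real \<Rightarrow> real"
  assumes "q \<in> lc_nondecreasing" "continuous_on UNIV h" "s \<le> t" "t \<le> u"
  shows "integral {s..u} (\<lambda>x. h (q x)) = integral {s..t} (\<lambda>x. h (q x)) + integral {t..u} (\<lambda>x. h (q x))"
  using Henstock_Kurzweil_Integration.integral_combine[OF assms(3,4) lc_comp_integrable[OF assms(1,2)]] by simp

section \<open>Symmetry of the slack and its zero set\<close>

context feasible_pair
begin

text \<open>Equality of the masses turns integrals from 0 into integrals up to 1. By this symmetry
  every fact about \<open>q1\<close> has a counterpart for \<open>q2\<close>.\<close>

lemma slack_swap:
  assumes "0 \<le> x" "x \<le> 1" "0 \<le> y" "y \<le> 1"
  shows "slack q2 q1 y x = slack q1 q2 x y"
  using lc_comp_combine[OF lc1, of "\<lambda>v. v" 0 x 1] lc_comp_combine[OF lc2, of "\<lambda>v. v" 0 y 1] assms mass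
  by (simp add: slack_def algebra_simps)

lemma swap: "feasible_pair q2 q1"
  using lc1 lc2 mass slack_nonneg slack_swap by unfold_locales simp_all

lemma gap_swap: "gap q1 q2 a b c d \<Longrightarrow> gap q2 q1 c d a b"
  unfolding gap_def using slack_swap by auto

lemma admissible_swap:
  assumes "admissible q2 q1 k h"
  shows "admissible q1 q2 h k"
proof -
  obtain L L' where L: "L-lipschitz_on UNIV h" "L'-lipschitz_on UNIV k"
    using assms unfolding admissible_def by blast
  have eq: "integral {0..1} (\<lambda>x. k (q2 x)) = integral {0..1} (\<lambda>x. h (q1 x))"
    using assms unfolding admissible_def by blast
  obtain C where C: "\<And>y x. y \<in> {0..1} \<Longrightarrow> x \<in> {0..1} \<Longrightarrow>
      \<bar>integral {0..x} (\<lambda>x. h (q1 x)) - integral {y..1} (\<lambda>x. k (q2 x))\<bar> \<le> C * slack q2 q1 y x"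
    using assms unfolding admissible_def by blast
  have bound: "\<bar>integral {0..y} (\<lambda>x. k (q2 x)) - integral {x..1} (\<lambda>x. h (q1 x))\<bar> \<le> C * slack q1 q2 x y"
    if "0 \<le> x" "x \<le> 1" "0 \<le> y" "y \<le> 1" for x y
    using C[of y x] slack_swap[OF that] eq that
      lc_comp_combine[OF lc1 lipschitz_on_continuous_on[OF L(1)] that(1,2)]
      lc_comp_combine[OF lc2 lipschitz_on_continuous_on[OF L(2)] that(3,4)]
    by simp
  have "h 0 = 0 \<and> h 1 = 0 \<and> k 0 = 0 \<and> k 1 = 0"
    using assms unfolding admissible_def by blast
  moreover have "\<forall>x\<in>{0..1}. \<forall>y\<in>{0..1}.
      \<bar>integral {0..y} (\<lambda>x. k (q2 x)) - integral {x..1} (\<lambda>x. h (q1 x))\<bar> \<le> C * slack q1 q2 x y"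
    using bound by simp
  ultimately show ?thesis
    using L eq unfolding admissible_def by auto
qed

text \<open>The slack has slope \<open>q1 t - (1 - y)\<close> in \<open>x\<close>; it is therefore
  convex in \<open>x\<close>.\<close>

lemma slack_diff_x:
  assumes "0 \<le> x" "x \<le> x'" "x' \<le> 1"
  shows "slack q1 q2 x' y = slack q1 q2 x y + integral {x..x'} (\<lambda>t. q1 t - (1 - y))"
proof -
  have "integral {x..x'} (\<lambda>t. q1 t - (1 - y)) = integral {x..x'} q1 - integral {x..x'} (\<lambda>_. 1 - y)"
    by (intro Henstock_Kurzweil_Integration.integral_diff lc_integrable[OF lc1] integrable_const_ivl)
  then have "integral {x..x'} (\<lambda>t. q1 t - (1 - y)) = integral {x..x'} q1 - (x' - x) * (1 - y)"
    using assms by simp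
  then show ?thesis
    using lc_comp_combine[OF lc1, of "\<lambda>v. v" x x' 1] assms
    by (simp add: slack_def algebra_simps)
qed

lemma slack_diff_y:
  assumes "0 \<le> y" "y \<le> y'" "y' \<le> 1"
  shows "slack q1 q2 x y' = slack q1 q2 x y + integral {y..y'} (\<lambda>t. q2 t - (1 - x))"
proof -
  have "integral {y..y'} (\<lambda>t. q2 t - (1 - x)) = integral {y..y'} q2 - integral {y..y'} (\<lambda>_. 1 - x)"
    by (intro Henstock_Kurzweil_Integration.integral_diff lc_integrable[OF lc2] integrable_const_ivl)
  then have "integral {y..y'} (\<lambda>t. q2 t - (1 - x)) = integral {y..y'} q2 - (y' - y) * (1 - x)"
    using assms by simp
  then show ?thesis
    using lc_comp_combine[OF lc2, of "\<lambda>v. v" 0 y y'] assms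
    by (simp add: slack_def algebra_simps)
qed

lemma integrable1: "(\<lambda>t. q1 t - s) integrable_on {u..w}"
  by (rule lc_comp_integrable[OF lc1, of "\<lambda>v. v - s"]) (intro continuous_intros)

lemma integrable2: "(\<lambda>t. q2 t - s) integrable_on {u..w}"
  by (rule lc_comp_integrable[OF lc2, of "\<lambda>v. v - s"]) (intro continuous_intros)

text \<open>All terms of the slack are separable except \<open>x * y\<close>, so its mixed
  difference is \<open>(x - x') * (y - y')\<close>. Nonnegativity then makes the zeros an antitone
  chain.\<close>

lemma slack_cross:
  assumes "slack q1 q2 x y = 0" "slack q1 q2 x' y' = 0"
    "x \<in> {0..1}" "x' \<in> {0..1}" "y \<in> {0..1}" "y' \<in> {0..1}"
  shows "(x - x') * (y - y') \<le> 0"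
proof -
  have "slack q1 q2 x y' + slack q1 q2 x' y + (x - x') * (y - y') = slack q1 q2 x y + slack q1 q2 x' y'"
    unfolding slack_def by algebra
  then show ?thesis
    using assms slack_nonneg[of x y'] slack_nonneg[of x' y] by simp
qed

lemma continuous_slack: "continuous_on ({0..1} \<times> {0..1}) (\<lambda>p. slack q1 q2 (fst p) (snd p))"
  unfolding slack_def
  by (intro continuous_intros
      continuous_on_compose2[OF indefinite_integral_continuous_1[OF lc_integrable[OF lc2]]]
      continuous_on_compose2[OF indefinite_integral_continuous_1'[OF lc_integrable[OF lc1]]]) auto

text \<open>A continuous function without zeros on a compact rectangle; an empty rectangle is
  allowed.\<close>

lemma slack_bounded_below:
  assumes "0 \<le> x0" "x1 \<le> 1" "0 \<le> y0" "y1 \<le> 1"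
    and pos: "\<And>x y. x0 \<le> x \<Longrightarrow> x \<le> x1 \<Longrightarrow> y0 \<le> y \<Longrightarrow> y \<le> y1 \<Longrightarrow> slack q1 q2 x y \<noteq> 0"
  obtains \<kappa> where "0 < \<kappa>"
    "\<And>x y. x0 \<le> x \<Longrightarrow> x \<le> x1 \<Longrightarrow> y0 \<le> y \<Longrightarrow> y \<le> y1 \<Longrightarrow> \<kappa> \<le> slack q1 q2 x y"
proof (cases "{x0..x1} \<times> {y0..y1} = {}")
  case True
  then show ?thesis using that[of 1] by auto
next
  case False
  have "continuous_on ({x0..x1} \<times> {y0..y1}) (\<lambda>p. slack q1 q2 (fst p) (snd p))"
    using continuous_slack by (rule continuous_on_subset) (use assms in auto)
  from continuous_attains_inf[OF compact_Times[OF compact_Icc compact_Icc] False this]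
  obtain p where p: "p \<in> {x0..x1} \<times> {y0..y1}"
      "\<And>p'. p' \<in> {x0..x1} \<times> {y0..y1} \<Longrightarrow> slack q1 q2 (fst p) (snd p) \<le> slack q1 q2 (fst p') (snd p')"
    by blast
  have "0 \<le> slack q1 q2 (fst p) (snd p)"
    using p(1) assms by (intro slack_nonneg) auto
  moreover have "slack q1 q2 (fst p) (snd p) \<noteq> 0"
    using p(1) by (intro pos) auto
  ultimately show ?thesis
    using that[of "slack q1 q2 (fst p) (snd p)"] p(2) by force
qed

text \<open>If \<open>q1\<close> exceeded \<open>1 - y\<close> at some \<open>t < x\<close>, the
  slack at height \<open>y\<close> would increase strictly from \<open>t\<close> to its zero at
  \<open>x\<close> and be negative at \<open>t\<close>. The point \<open>x\<close> itself follows by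
  left continuity, or from \<open>q1 0 = 0\<close>.\<close>

lemma zero_le:
  assumes z: "slack q1 q2 x y = 0" and x: "0 \<le> x" "x \<le> 1" and y: "0 \<le> y" "y \<le> 1"
    and t: "0 \<le> t" "t \<le> x"
  shows "q1 t \<le> 1 - y"
proof -
  have less: "q1 t \<le> 1 - y" if t: "0 \<le> t" "t < x" for t
  proof (rule ccontr)
    assume "\<not> q1 t \<le> 1 - y"
    then have "0 < (x - t) * (q1 t - (1 - y))"
      using t by simp
    also have "\<dots> \<le> integral {t..x} (\<lambda>t. q1 t - (1 - y))"
      using t x lc_mono[OF lc1] by (intro integral_ge_const integrable1) auto
    also have "\<dots> = - slack q1 q2 t y"
      using slack_diff_x[of t x y] t x z by simp
    finally show False
      using slack_nonneg[of t y] t x y by simp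
  qed
  consider "t < x" | "t = x" "x = 0" | "t = x" "0 < x"
    using t x by linarith
  then show ?thesis
  proof cases
    case 1
    then show ?thesis using less t by simp
  next
    case 2
    then show ?thesis using lc_0[OF lc1] y by simp
  next
    case 3
    have "q1 x \<le> 1 - y"
      by (rule lc_leI[OF lc1 order_refl 3(2) x(2)]) (simp add: less)
    then show ?thesis
      using 3 by simp
  qed
qed

text \<open>Otherwise the slack at height \<open>y\<close> would decrease strictly from its zero at
  \<open>x\<close> and be negative at \<open>t\<close>.\<close>

lemma zero_ge:
  assumes z: "slack q1 q2 x y = 0" and x: "0 \<le> x" and y: "0 \<le> y" "y \<le> 1"
    and t: "x < t" "t \<le> 1"
  shows "1 - y \<le> q1 t"
proof (rule ccontr)
  assume "\<not> 1 - y \<le> q1 t"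
  then have "(t - x) * (q1 t - (1 - y)) < 0"
    using t by (simp add: mult_pos_neg)
  moreover have "integral {x..t} (\<lambda>t. q1 t - (1 - y)) \<le> (t - x) * (q1 t - (1 - y))"
    using t x lc_mono[OF lc1] by (intro integral_le_const integrable1) auto
  moreover have "integral {x..t} (\<lambda>t. q1 t - (1 - y)) = slack q1 q2 t y"
    using slack_diff_x[of x t y] t x z by simp
  ultimately show False
    using slack_nonneg[of t y] t x y by simp
qed

end

section \<open>Small multiples of admissible perturbations\<close>

text \<open>The bound on \<open>s\<close> makes \<open>v + s * h v\<close> nondecreasing in
  \<open>v\<close>, and it fixes 0 and 1.\<close>

lemma lc_perturb:
  fixes h :: "real \<Rightarrow> real"
  assumes q: "q \<in> lc_nondecreasing" and lip: "L-lipschitz_on UNIV h" and h: "h 0 = 0" "h 1 = 0"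
    and s: "\<bar>s\<bar> * L \<le> 1"
  shows "(\<lambda>x. q x + s * h (q x)) \<in> lc_nondecreasing"
proof (rule lc_comp[OF q, of "\<lambda>v. v + s * h v"])
  show "mono (\<lambda>v. v + s * h v)"
  proof
    fix v w :: real assume vw: "v \<le> w"
    have "\<bar>h w - h v\<bar> \<le> L * (w - v)"
      using lipschitz_onD[OF lip, of w v] vw by (simp add: dist_real_def)
    then have "\<bar>s * (h w - h v)\<bar> \<le> \<bar>s\<bar> * (L * (w - v))"
      by (simp add: abs_mult mult_left_mono)
    also have "\<dots> \<le> 1 * (w - v)"
      using mult_right_mono[OF s, of "w - v"] vw by (simp add: mult.assoc)
    finally show "v + s * h v \<le> w + s * h w"
      by (simp add: algebra_simps abs_le_iff)
  qed
  show "continuous_on UNIV (\<lambda>v. v + s * h v)"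
    by (intro continuous_intros lipschitz_on_continuous_on[OF lip])
qed (use h in simp_all)

context feasible_pair
begin

lemma admissible_perturb:
  assumes "admissible q1 q2 h k"
  obtains e where "0 < e" "\<And>s. \<bar>s\<bar> \<le> e \<Longrightarrow> feasible_pair (\<lambda>x. q1 x + s * h (q1 x)) (\<lambda>x. q2 x + s * k (q2 x))"
proof -
  obtain L1 L2 where L: "L1-lipschitz_on UNIV h" "L2-lipschitz_on UNIV k"
    using assms unfolding admissible_def by blast
  have 0: "h 0 = 0" "h 1 = 0" "k 0 = 0" "k 1 = 0"
    and eq: "integral {0..1} (\<lambda>x. h (q1 x)) = integral {0..1} (\<lambda>x. k (q2 x))"
    using assms unfolding admissible_def by blast+
  obtain C where C: "\<And>x y. x \<in> {0..1} \<Longrightarrow> y \<in> {0..1} \<Longrightarrow>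
      \<bar>integral {0..y} (\<lambda>x. k (q2 x)) - integral {x..1} (\<lambda>x. h (q1 x))\<bar> \<le> C * slack q1 q2 x y"
    using assms unfolding admissible_def by blast
  have Lpos: "0 \<le> L1" "0 \<le> L2"
    using L by (auto dest: lipschitz_on_nonneg)
  \<comment> \<open>For steps up to \<open>e\<close> the products of \<open>\<bar>s\<bar>\<close>
    with \<open>L1\<close>, \<open>L2\<close> and \<open>\<bar>C\<bar>\<close> are all at most 1:
    the first two keep monotonicity, the third keeps the slack nonnegative.\<close>
  define e where "e = 1 / (1 + L1 + L2 + \<bar>C\<bar>)"
  have e: "0 < e"
    using Lpos by (simp add: e_def)
  have small: "\<bar>s\<bar> * B \<le> 1" if "\<bar>s\<bar> \<le> e" "0 \<le> B" "B \<le> 1 + L1 + L2 + \<bar>C\<bar>" for s B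
  proof -
    have "\<bar>s\<bar> * B \<le> e * (1 + L1 + L2 + \<bar>C\<bar>)"
      using that e by (intro mult_mono) auto
    also have "\<dots> = 1"
      using Lpos by (simp add: e_def)
    finally show ?thesis .
  qed
  have step: "integral {u..w} (\<lambda>x. q1 x + s * h (q1 x)) = integral {u..w} q1 + s * integral {u..w} (\<lambda>x. h (q1 x))"
    "integral {u..w} (\<lambda>x. q2 x + s * k (q2 x)) = integral {u..w} q2 + s * integral {u..w} (\<lambda>x. k (q2 x))" for u w s
    using lc_integrable[OF lc1, of u w] lc_integrable[OF lc2, of u w]
      lc_comp_lipschitz_integrable[OF lc1 L(1), of u w] lc_comp_lipschitz_integrable[OF lc2 L(2), of u w]
    by (subst Henstock_Kurzweil_Integration.integral_add; simp add: integrable_on_mult_right)+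
  have "feasible_pair (\<lambda>x. q1 x + s * h (q1 x)) (\<lambda>x. q2 x + s * k (q2 x))" if s: "\<bar>s\<bar> \<le> e" for s
  proof
    show "(\<lambda>x. q1 x + s * h (q1 x)) \<in> lc_nondecreasing"
      using Lpos by (intro lc_perturb[OF lc1 L(1) 0(1,2)] small[OF s]) auto
    show "(\<lambda>x. q2 x + s * k (q2 x)) \<in> lc_nondecreasing"
      using Lpos by (intro lc_perturb[OF lc2 L(2) 0(3,4)] small[OF s]) auto
    show "integral {0..1} (\<lambda>x. q1 x + s * h (q1 x)) = integral {0..1} (\<lambda>x. q2 x + s * k (q2 x))"
      using mass eq by (simp add: step)
    fix x y :: real
    assume xy: "0 \<le> x" "x \<le> 1" "0 \<le> y" "y \<le> 1"
    \<comment> \<open>The change of the slack per unit of \<open>s\<close>.\<close>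
    define E where "E = integral {0..y} (\<lambda>x. k (q2 x)) - integral {x..1} (\<lambda>x. h (q1 x))"
    have S: "0 \<le> slack q1 q2 x y"
      using slack_nonneg[OF xy] .
    have "\<bar>s * E\<bar> \<le> \<bar>s\<bar> * (C * slack q1 q2 x y)"
      using C[of x y] xy by (simp add: abs_mult E_def mult_left_mono)
    also have "\<dots> \<le> \<bar>s\<bar> * (\<bar>C\<bar> * slack q1 q2 x y)"
      using S by (intro mult_left_mono mult_right_mono) auto
    also have "\<dots> = (\<bar>s\<bar> * \<bar>C\<bar>) * slack q1 q2 x y"
      by simp
    also have "\<dots> \<le> 1 * slack q1 q2 x y"
      using small[OF s, of "\<bar>C\<bar>"] Lpos S by (intro mult_right_mono) auto
    finally have "\<bar>s * E\<bar> \<le> slack q1 q2 x y"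
      by simp
    moreover have "slack (\<lambda>x. q1 x + s * h (q1 x)) (\<lambda>x. q2 x + s * k (q2 x)) x y = slack q1 q2 x y + s * E"
      by (simp add: slack_def step E_def algebra_simps)
    ultimately show "0 \<le> slack (\<lambda>x. q1 x + s * h (q1 x)) (\<lambda>x. q2 x + s * k (q2 x)) x y"
      by (simp add: abs_le_iff)
  qed
  then show ?thesis
    using that e by blast
qed

text \<open>Admissible pairs form a vector space, so two of them can be combined to cancel their
  effect on the linear constraint.\<close>

lemma admissible_combination:
  assumes "admissible q1 q2 h k" "admissible q1 q2 h' k'"
  shows "admissible q1 q2 (\<lambda>v. s * h v + s' * h' v) (\<lambda>v. s * k v + s' * k' v)"
proof -
  obtain L1 L2 L1' L2' where L: "L1-lipschitz_on UNIV h" "L2-lipschitz_on UNIV k"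
      "L1'-lipschitz_on UNIV h'" "L2'-lipschitz_on UNIV k'"
    using assms unfolding admissible_def by blast
  have 0: "h 0 = 0" "h 1 = 0" "k 0 = 0" "k 1 = 0" "h' 0 = 0" "h' 1 = 0" "k' 0 = 0" "k' 1 = 0"
    and eq: "integral {0..1} (\<lambda>x. h (q1 x)) = integral {0..1} (\<lambda>x. k (q2 x))"
      "integral {0..1} (\<lambda>x. h' (q1 x)) = integral {0..1} (\<lambda>x. k' (q2 x))"
    using assms unfolding admissible_def by blast+
  obtain C where C: "\<And>x y. x \<in> {0..1} \<Longrightarrow> y \<in> {0..1} \<Longrightarrow>
      \<bar>integral {0..y} (\<lambda>x. k (q2 x)) - integral {x..1} (\<lambda>x. h (q1 x))\<bar> \<le> C * slack q1 q2 x y"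
    using assms(1) unfolding admissible_def by blast
  obtain C' where C': "\<And>x y. x \<in> {0..1} \<Longrightarrow> y \<in> {0..1} \<Longrightarrow>
      \<bar>integral {0..y} (\<lambda>x. k' (q2 x)) - integral {x..1} (\<lambda>x. h' (q1 x))\<bar> \<le> C' * slack q1 q2 x y"
    using assms(2) unfolding admissible_def by blast
  have comb: "integral {u..w} (\<lambda>x. s * h (q1 x) + s' * h' (q1 x)) = s * integral {u..w} (\<lambda>x. h (q1 x)) + s' * integral {u..w} (\<lambda>x. h' (q1 x))"
    "integral {u..w} (\<lambda>x. s * k (q2 x) + s' * k' (q2 x)) = s * integral {u..w} (\<lambda>x. k (q2 x)) + s' * integral {u..w} (\<lambda>x. k' (q2 x))" for u w
    using L[THEN lc_comp_lipschitz_integrable[OF lc1], of u w] L[THEN lc_comp_lipschitz_integrable[OF lc2], of u w]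
    by (subst Henstock_Kurzweil_Integration.integral_add; simp add: integrable_on_mult_right)+
  show ?thesis
  proof (rule admissibleI)
    show "(\<bar>s\<bar> * L1 + \<bar>s'\<bar> * L1')-lipschitz_on UNIV (\<lambda>v. s * h v + s' * h' v)"
      by (intro lipschitz_on_add lipschitz_on_cmult_real L)
    show "(\<bar>s\<bar> * L2 + \<bar>s'\<bar> * L2')-lipschitz_on UNIV (\<lambda>v. s * k v + s' * k' v)"
      by (intro lipschitz_on_add lipschitz_on_cmult_real L)
    show "integral {0..1} (\<lambda>x. s * h (q1 x) + s' * h' (q1 x)) = integral {0..1} (\<lambda>x. s * k (q2 x) + s' * k' (q2 x))"
      by (simp add: comb eq)
    fix x y :: real
    assume "0 \<le> x" "x \<le> 1" "0 \<le> y" "y \<le> 1"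
    then have xy: "x \<in> {0..1}" "y \<in> {0..1}" by auto
    define E where "E = integral {0..y} (\<lambda>x. k (q2 x)) - integral {x..1} (\<lambda>x. h (q1 x))"
    define E' where "E' = integral {0..y} (\<lambda>x. k' (q2 x)) - integral {x..1} (\<lambda>x. h' (q1 x))"
    have "\<bar>s * E + s' * E'\<bar> \<le> \<bar>s\<bar> * \<bar>E\<bar> + \<bar>s'\<bar> * \<bar>E'\<bar>"
      using abs_triangle_ineq[of "s * E" "s' * E'"] by (simp add: abs_mult)
    also have "\<dots> \<le> \<bar>s\<bar> * (C * slack q1 q2 x y) + \<bar>s'\<bar> * (C' * slack q1 q2 x y)"
      using C[OF xy] C'[OF xy] unfolding E_def E'_def by (intro add_mono mult_left_mono) auto
    finally show "\<bar>integral {0..y} (\<lambda>x. s * k (q2 x) + s' * k' (q2 x)) -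
        integral {x..1} (\<lambda>x. s * h (q1 x) + s' * h' (q1 x))\<bar> \<le> (\<bar>s\<bar> * C + \<bar>s'\<bar> * C') * slack q1 q2 x y"
      by (simp add: comb E_def E'_def algebra_simps)
  qed (simp_all add: 0)
qed

end

section \<open>The linear constraint and extremality\<close>

lemma weighted_integrable:
  assumes q: "q \<in> lc_nondecreasing" and h: "continuous_on UNIV (h :: real \<Rightarrow> real)" and \<psi>: "essentially_bounded \<psi>"
  shows "set_integrable lebesgue {0..1} (\<lambda>x. h (q x) * \<psi> x)"
proof -
  have "compact (h ` {0..1::real})"
    using h by (intro compact_continuous_image) (auto intro: continuous_on_subset)
  then obtain B where "\<forall>v \<in> {0..1}. norm (h v) \<le> B"
    by (meson bounded_iff compact_imp_bounded imageI)
  then have B: "\<bar>h (q x)\<bar> \<le> B" for x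
    using lc_range[OF q] by simp
  obtain C where C: "AE x in lebesgue_on {0..1}. \<bar>\<psi> x\<bar> \<le> C"
    using \<psi> by (auto simp: essentially_bounded_def)
  have [measurable]: "\<psi> \<in> borel_measurable (lebesgue_on {0..1})"
    using \<psi> by (simp add: essentially_bounded_def)
  have "(\<lambda>x. h (q x)) \<in> borel_measurable borel"
    using measurable_compose[OF lc_measurable[OF q] borel_measurable_continuous_onI[OF h]] .
  then have [measurable]: "(\<lambda>x. h (q x)) \<in> borel_measurable (lebesgue_on {0..1})"
    by (intro measurable_restrict_space1 measurable_completion) simp
  have "AE x in lebesgue_on {0..1}. norm (h (q x) * \<psi> x) \<le> B * C"
    using C
  proof eventually_elim
    case (elim x)
    have "\<bar>h (q x)\<bar> * \<bar>\<psi> x\<bar> \<le> B * C"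
      using B[of x] elim by (intro mult_mono) auto
    then show ?case
      by (simp add: abs_mult)
  qed
  then have "integrable (lebesgue_on {0..1}) (\<lambda>x. h (q x) * \<psi> x)"
    by (intro finite_measure.integrable_const_bound[of _ _ "B * C"] finite_measure_lebesgue_on) auto
  then show ?thesis
    by (simp add: set_integrable_def integrable_restrict_space)
qed

definition payoff :: "(real \<Rightarrow> real) \<Rightarrow> (real \<Rightarrow> real) \<Rightarrow> real"
  where "payoff \<psi> f = set_lebesgue_integral lebesgue {0..1} (\<lambda>x. f x * \<psi> x)"

lemma payoff_linear:
  fixes h k :: "real \<Rightarrow> real"
  assumes q: "q \<in> lc_nondecreasing" and hk: "continuous_on UNIV h" "continuous_on UNIV k"
    and \<psi>: "essentially_bounded \<psi>"
  shows "payoff \<psi> (\<lambda>x. r * h (q x) + s * k (q x)) = r * payoff \<psi> (\<lambda>x. h (q x)) + s * payoff \<psi> (\<lambda>x. k (q x))"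
proof -
  have "set_lebesgue_integral lebesgue {0..1} (\<lambda>x. r * (h (q x) * \<psi> x) + s * (k (q x) * \<psi> x)) =
      r * payoff \<psi> (\<lambda>x. h (q x)) + s * payoff \<psi> (\<lambda>x. k (q x))"
    unfolding payoff_def
    using weighted_integrable[OF q hk(1) \<psi>] weighted_integrable[OF q hk(2) \<psi>]
    by (subst set_integral_add(2)) auto
  then show ?thesis
    by (simp add: payoff_def algebra_simps)
qed

lemma feasible_set_iff:
  "(q1, q2) \<in> feasible_set \<psi>1 \<psi>2 \<eta> \<longleftrightarrow> feasible_pair q1 q2 \<and> payoff \<psi>1 q1 + payoff \<psi>2 q2 \<le> \<eta>"
  using feasible_pair_iff[of q1 q2] feasible_pair.lc1[of q1 q2] feasible_pair.lc2[of q1 q2]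
  by (auto simp: feasible_set_def payoff_def)

text \<open>The perturbations of \<open>(q1, q2)\<close> induced by admissible pairs span at most
  one dimension. Dependence concerns the compositions, since \<open>h\<close> and \<open>k\<close>
  are arbitrary at levels that \<open>q1\<close> and \<open>q2\<close> do not take.\<close>

definition rank_one :: "(real \<Rightarrow> real) \<Rightarrow> (real \<Rightarrow> real) \<Rightarrow> bool"
  where "rank_one q1 q2 \<longleftrightarrow> (\<forall>h k h' k'. admissible q1 q2 h k \<longrightarrow> admissible q1 q2 h' k' \<longrightarrow>
    (\<exists>s s'. (s \<noteq> 0 \<or> s' \<noteq> 0) \<and>
      (\<forall>x. s * h (q1 x) + s' * h' (q1 x) = 0 \<and> s * k (q2 x) + s' * k' (q2 x) = 0)))"

lemma rank_oneD:
  assumes "rank_one q1 q2" "admissible q1 q2 h k" "admissible q1 q2 h' k'"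
  shows "\<exists>s s'. (s \<noteq> 0 \<or> s' \<noteq> 0) \<and>
    (\<forall>x. s * h (q1 x) + s' * h' (q1 x) = 0) \<and> (\<forall>x. s * k (q2 x) + s' * k' (q2 x) = 0)"
  using assms(1)[unfolded rank_one_def, rule_format, OF assms(2,3)] by blast

text \<open>An admissible pair that leaves the payoff unchanged can be added in both directions, so
  extremality forces it to vanish. A two-dimensional space of perturbations would contain a nonzero
  pair of this kind.\<close>

lemma (in feasible_pair) extreme_rank_one:
  assumes \<psi>: "essentially_bounded \<psi>1" "essentially_bounded \<psi>2"
    and ext: "(q1, q2) extreme_point_of feasible_set \<psi>1 \<psi>2 \<eta>"
  shows "rank_one q1 q2"
proof -
  have mem: "(q1, q2) \<in> feasible_set \<psi>1 \<psi>2 \<eta>"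
    using ext by (simp add: extreme_point_of_def)
  define V where "V h k = payoff \<psi>1 (\<lambda>x. h (q1 x)) + payoff \<psi>2 (\<lambda>x. k (q2 x))" for h k
  have cont: "continuous_on UNIV h" "continuous_on UNIV k" if "admissible q1 q2 h k" for h k
    using that lipschitz_on_continuous_on unfolding admissible_def by blast+
  have V_comb: "V (\<lambda>v. s * h v + s' * h' v) (\<lambda>v. s * k v + s' * k' v) = s * V h k + s' * V h' k'"
    if "admissible q1 q2 h k" "admissible q1 q2 h' k'" for h k h' k' s s'
    unfolding V_def payoff_linear[OF lc1 cont(1)[OF that(1)] cont(1)[OF that(2)] \<psi>(1)]
      payoff_linear[OF lc2 cont(2)[OF that(1)] cont(2)[OF that(2)] \<psi>(2)]
    by (simp add: distrib_left)
  have zero: "h (q1 x) = 0 \<and> k (q2 x) = 0" if adm: "admissible q1 q2 h k" and V0: "V h k = 0" for h k x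
  proof -
    obtain e where e: "0 < e"
      and feas: "\<And>s. \<bar>s\<bar> \<le> e \<Longrightarrow> feasible_pair (\<lambda>x. q1 x + s * h (q1 x)) (\<lambda>x. q2 x + s * k (q2 x))"
      using admissible_perturb[OF adm] by metis
    define P where "P s = ((\<lambda>x. q1 x + s * h (q1 x)), (\<lambda>x. q2 x + s * k (q2 x)))" for s
    have P: "P s \<in> feasible_set \<psi>1 \<psi>2 \<eta>" if "\<bar>s\<bar> \<le> e" for s
    proof -
      have "payoff \<psi>1 (\<lambda>x. q1 x + s * h (q1 x)) + payoff \<psi>2 (\<lambda>x. q2 x + s * k (q2 x)) =
          payoff \<psi>1 q1 + payoff \<psi>2 q2 + s * V h k"
        using payoff_linear[OF lc1 _ cont(1)[OF adm] \<psi>(1), of "\<lambda>v. v" 1 s]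
          payoff_linear[OF lc2 _ cont(2)[OF adm] \<psi>(2), of "\<lambda>v. v" 1 s]
        by (simp add: V_def algebra_simps)
      then show ?thesis
        using feas[OF that] mem V0 by (simp add: P_def feasible_set_iff)
    qed
    have mid: "(q1, q2) = (1 - 1/2) *\<^sub>R P e + (1/2) *\<^sub>R P (- e)"
      by (simp add: P_def scaleR_fun_def plus_fun_def fun_eq_iff algebra_simps)
    have "(q1, q2) \<notin> open_segment (P e) (P (- e))"
      using ext P[of e] P[of "- e"] e by (simp add: extreme_point_of_def)
    moreover have "0 < (1/2::real) \<and> (1/2::real) < 1"
      by simp
    \<comment> \<open>The midpoint lies in the open segment unless the two end points
      coincide.\<close>
    ultimately have "P e = P (- e)"
      unfolding in_segment using mid by blast
    then have "e * h (q1 x) = - e * h (q1 x)" "e * k (q2 x) = - e * k (q2 x)"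
      by (auto simp: P_def fun_eq_iff)
    then show ?thesis
      using e by simp
  qed
  show ?thesis
    unfolding rank_one_def
  proof (intro allI impI)
    fix h k h' k'
    assume adm: "admissible q1 q2 h k" "admissible q1 q2 h' k'"
    \<comment> \<open>A nontrivial solution of one linear equation in two unknowns.\<close>
    obtain s s' where ss: "s \<noteq> 0 \<or> s' \<noteq> 0" "s * V h k + s' * V h' k' = 0"
    proof (cases "V h k = 0")
      case True
      then show ?thesis using that[of 1 0] by simp
    next
      case False
      then show ?thesis using that[of "- V h' k'" "V h k"] by (simp add: mult.commute)
    qed
    then have "V (\<lambda>v. s * h v + s' * h' v) (\<lambda>v. s * k v + s' * k' v) = 0"
      using V_comb[OF adm] by simp
    then have "s * h (q1 x) + s' * h' (q1 x) = 0 \<and> s * k (q2 x) + s' * k' (q2 x) = 0" for x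
      using zero[OF admissible_combination[OF adm]] by simp
    then show "\<exists>s s'. (s \<noteq> 0 \<or> s' \<noteq> 0) \<and>
      (\<forall>x. s * h (q1 x) + s' * h' (q1 x) = 0 \<and> s * k (q2 x) + s' * k' (q2 x) = 0)"
      using ss(1) by blast
  qed
qed

section \<open>Gaps in the zero set of the slack\<close>

locale gap_pair = feasible_pair +
  fixes a b c d :: real
  assumes gap: "gap q1 q2 a b c d"
begin

lemma order: "0 \<le> a" "a < b" "b \<le> 1" "0 \<le> c" "c < d" "d \<le> 1"
  using gap by (auto simp: gap_def)

lemma corner: "slack q1 q2 a d = 0" "slack q1 q2 b c = 0"
  using gap by (auto simp: gap_def)

lemma zeroD:
  "slack q1 q2 x y = 0 \<Longrightarrow> 0 \<le> x \<Longrightarrow> x \<le> 1 \<Longrightarrow> 0 \<le> y \<Longrightarrow> y \<le> 1 \<Longrightarrow> x \<le> a \<and> d \<le> y \<or> b \<le> x \<and> y \<le> c"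
  using gap by (auto simp: gap_def)

lemma gap_pair_swap: "gap_pair q2 q1 c d a b"
  using swap gap_swap[OF gap] by (simp add: gap_pair_def gap_pair_axioms_def)

lemma below: "0 \<le> t \<Longrightarrow> t \<le> a \<Longrightarrow> q1 t \<le> 1 - d"
  using zero_le[OF corner(1)] order by simp

lemma above: "b < t \<Longrightarrow> t \<le> 1 \<Longrightarrow> 1 - c \<le> q1 t"
  using zero_ge[OF corner(2)] order by simp

lemma inside_weak: "a < t \<Longrightarrow> t \<le> b \<Longrightarrow> 1 - d \<le> q1 t \<and> q1 t \<le> 1 - c"
  using zero_ge[OF corner(1), of t] zero_le[OF corner(2), of t] order by simp

text \<open>If \<open>q1\<close> took the value \<open>1 - d\<close> at \<open>t\<close>, the slack
  at height \<open>d\<close> would not increase from its zero at \<open>a\<close> to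
  \<open>t\<close>, giving a zero strictly inside the gap. The value \<open>1 - c\<close> is
  excluded in the same way from the corner at \<open>b\<close>.\<close>

lemma inside:
  assumes "a < t" "t < b"
  shows "1 - d < q1 t" "q1 t < 1 - c"
proof -
  have "q1 t \<noteq> 1 - d"
  proof
    assume eq: "q1 t = 1 - d"
    have "q1 u - (1 - d) \<le> 0" if "a < u" "u < t" for u
      using lc_mono[OF lc1, of u t] that eq order assms by simp
    then have "integral {a..t} (\<lambda>u. q1 u - (1 - d)) \<le> (t - a) * 0"
      using assms by (intro integral_le_const integrable1) auto
    then have "slack q1 q2 t d \<le> 0"
      using slack_diff_x[of a t d] corner order assms by simp
    then have "slack q1 q2 t d = 0"
      using slack_nonneg[of t d] order assms by simp
    then show False
      using zeroD[of t d] order assms by simp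
  qed
  moreover have "q1 t \<noteq> 1 - c"
  proof
    assume eq: "q1 t = 1 - c"
    have "0 \<le> q1 u - (1 - c)" if "t < u" "u < b" for u
      using lc_mono[OF lc1, of t u] that eq order assms by simp
    then have "(b - t) * 0 \<le> integral {t..b} (\<lambda>u. q1 u - (1 - c))"
      using assms by (intro integral_ge_const integrable1) auto
    then have "slack q1 q2 t c \<le> 0"
      using slack_diff_x[of t b c] corner order assms by simp
    then have "slack q1 q2 t c = 0"
      using slack_nonneg[of t c] order assms by simp
    then show False
      using zeroD[of t c] order assms by simp
  qed
  ultimately show "1 - d < q1 t" "q1 t < 1 - c"
    using inside_weak[of t] assms by simp_all
qed

lemmas q2_below = gap_pair.below[OF gap_pair_swap]
  and q2_above = gap_pair.above[OF gap_pair_swap]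
  and q2_inside_weak = gap_pair.inside_weak[OF gap_pair_swap]
  and q2_inside = gap_pair.inside[OF gap_pair_swap]

section \<open>The perturbation of a gap that changes the total mass\<close>

abbreviation tent2 :: "real \<Rightarrow> real"
  where "tent2 t \<equiv> tent (1 - b) (1 - a) (q2 t)"

lemma integrable_tent1: "(\<lambda>t. tent p r (q1 t)) integrable_on {s..u}"
  by (rule lc_comp_integrable[OF lc1 tent_continuous])

lemma integrable_tent2: "(\<lambda>t. tent p r (q2 t)) integrable_on {s..u}"
  by (rule lc_comp_integrable[OF lc2 tent_continuous])

text \<open>For \<open>y < d\<close> the tent is at most \<open>1 - a - q2\<close>, whose integral
  over \<open>{y..d}\<close> is the slack at \<open>(a, y)\<close> because \<open>(a, d)\<close> is
  a zero. To the left of \<open>a\<close> one has \<open>q1 \<le> 1 - d\<close>, so the slack at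
  this height is only larger there.\<close>

lemma tail_left:
  assumes "0 \<le> x" "x \<le> a" "0 \<le> y" "y \<le> 1"
  shows "integral {y..1} tent2 \<le> slack q1 q2 x y"
proof (cases "d \<le> y")
  case True
  have "integral {y..1} tent2 = (1 - y) * 0"
    using True assms q2_above by (intro integral_eq_const integrable_tent2 tent_eq_0) auto
  then show ?thesis
    using slack_nonneg assms order by simp
next
  case False
  have "integral {d..1} tent2 = (1 - d) * 0"
    using order q2_above by (intro integral_eq_const integrable_tent2 tent_eq_0) auto
  then have "integral {y..1} tent2 = integral {y..d} tent2"
    using lc_comp_combine[OF lc2 tent_continuous, of y d 1 "1 - b" "1 - a"] False order by simp
  also have "\<dots> \<le> integral {y..d} (\<lambda>t. - (q2 t - (1 - a)))"
  proof (intro integral_le_interior integrable_tent2 integrable_neg integrable2)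
    fix t assume "y < t" "t < d"
    then have "q2 t \<le> 1 - a"
      using q2_below[of t] q2_inside_weak[of t] order assms by (cases "t \<le> c") auto
    then show "tent2 t \<le> - (q2 t - (1 - a))"
      using tent_le2[of "q2 t" "1 - a" "1 - b"] by simp
  qed
  also have "\<dots> = - integral {y..d} (\<lambda>t. q2 t - (1 - a))"
    by (rule integral_neg)
  also have "\<dots> = slack q1 q2 a y"
    using slack_diff_y[of y d a] False assms order corner by simp
  also have "\<dots> \<le> slack q1 q2 x y"
  proof -
    have "integral {x..a} (\<lambda>t. q1 t - (1 - y)) \<le> (a - x) * 0"
    proof (intro integral_le_const integrable1)
      fix t assume "x < t" "t < a"
      then show "q1 t - (1 - y) \<le> 0"
        using below[of t] False assms by simp
    qed (use assms in simp)
    then show ?thesis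
      using slack_diff_x[of x a y] assms order by simp
  qed
  finally show ?thesis .
qed

text \<open>The mirror image at the corner \<open>(b, c)\<close>: the tent is at most
  \<open>q2 - (1 - b)\<close>, and the slack grows to the right of \<open>b\<close>.\<close>

lemma tail_right:
  assumes "b \<le> x" "x \<le> 1" "0 \<le> y" "y \<le> 1"
  shows "integral {0..y} tent2 \<le> slack q1 q2 x y"
proof (cases "y \<le> c")
  case True
  have "integral {0..y} tent2 = (y - 0) * 0"
    using True assms q2_below by (intro integral_eq_const integrable_tent2 tent_eq_0) auto
  then show ?thesis
    using slack_nonneg assms order by simp
next
  case False
  have "integral {0..c} tent2 = (c - 0) * 0"
    using order q2_below by (intro integral_eq_const integrable_tent2 tent_eq_0) auto
  then have "integral {0..y} tent2 = integral {c..y} tent2"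
    using lc_comp_combine[OF lc2 tent_continuous, of 0 c y "1 - b" "1 - a"] False order by simp
  also have "\<dots> \<le> integral {c..y} (\<lambda>t. q2 t - (1 - b))"
  proof (intro integral_le_interior integrable_tent2 integrable2)
    fix t assume "c < t" "t < y"
    then have "1 - b \<le> q2 t"
      using q2_above[of t] q2_inside_weak[of t] order assms by (cases "t \<le> d") auto
    then show "tent2 t \<le> q2 t - (1 - b)"
      by (rule tent_le1)
  qed
  also have "\<dots> = slack q1 q2 b y"
    using slack_diff_y[of c y b] False assms order corner by simp
  also have "\<dots> \<le> slack q1 q2 x y"
  proof -
    have "(x - b) * 0 \<le> integral {b..x} (\<lambda>t. q1 t - (1 - y))"
    proof (intro integral_ge_const integrable1)
      fix t assume "b < t" "t < x"
      then show "0 \<le> q1 t - (1 - y)"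
        using above[of t] False assms by simp
    qed (use assms in simp)
    then show ?thesis
      using slack_diff_x[of b x y] assms order by simp
  qed
  finally show ?thesis .
qed

text \<open>Tents on the level ranges of the gap are scaled to have equal mass. Constancy of
  \<open>q1\<close> reduces the slack bound to \<open>x \<le> a\<close> and
  \<open>b \<le> x\<close>, where the tail estimates apply.\<close>

lemma bulk_perturbation:
  assumes "\<forall>t\<in>{a<..<b}. q1 t = w"
  shows "\<exists>h k. admissible q1 q2 h k \<and> (\<forall>t\<in>{a<..<b}. h (q1 t) \<noteq> 0) \<and>
    (\<forall>t\<in>{0..1} - {a<..b}. h (q1 t) = 0)"
proof -
  have const: "q1 t = w" if "a < t" "t < b" for t
    using assms that by simp
  define h0 where "h0 = tent (1 - d) (1 - c)"
  define k0 where "k0 = tent (1 - b) (1 - a)"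
  define \<alpha> where "\<alpha> = integral {0..1} (\<lambda>t. h0 (q1 t))"
  define \<beta> where "\<beta> = integral {0..1} (\<lambda>t. k0 (q2 t))"
  \<comment> \<open>Each tent is scaled by the mass of the other, so both integrals equal
    \<open>\<alpha> * \<beta>\<close>.\<close>
  define h where "h = (\<lambda>v. \<beta> * h0 v)"
  define k where "k = (\<lambda>v. \<alpha> * k0 v)"
  define x0 where "x0 = (a + b) / 2"
  define y0 where "y0 = (c + d) / 2"
  have x0: "a < x0" "x0 < b" and y0: "c < y0" "y0 < d"
    using order by (simp_all add: x0_def y0_def)
  have I1: "(\<lambda>t. h0 (q1 t)) integrable_on {s..u}" and I2: "(\<lambda>t. k0 (q2 t)) integrable_on {s..u}" for s u
    by (simp_all add: h0_def k0_def integrable_tent1 integrable_tent2)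
  have h0: "0 < h0 (q1 t)" if "a < t" "t < b" for t
    using inside[OF that] by (simp add: h0_def tent_pos)
  then have "0 < h0 w"
    using x0 const by metis
  have h0_out: "h0 (q1 t) = 0" if "0 \<le> t" "t \<le> 1" "t \<le> a \<or> b < t" for t
    unfolding h0_def using below[of t] above[of t] that by (intro tent_eq_0) auto
  have \<alpha>: "0 < \<alpha>"
    unfolding \<alpha>_def h0_def
    using h0[OF x0] x0 order by (intro lc_comp_integral_pos[OF lc1 tent_continuous, of _ _ x0]) (auto simp: tent_nonneg h0_def)
  have \<beta>: "0 < \<beta>"
    unfolding \<beta>_def k0_def
    using q2_inside[OF y0] y0 order
    by (intro lc_comp_integral_pos[OF lc2 tent_continuous, of _ _ y0]) (auto simp: tent_nonneg intro: tent_pos)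
  \<comment> \<open>With \<open>\<alpha> \<le> 1\<close> the tail estimates give the slack bound
    with constant 1.\<close>
  have "\<alpha> \<le> (1 - 0) * 1"
    unfolding \<alpha>_def using order lc_range[OF lc1]
    by (intro integral_le_const I1) (auto simp: h0_def tent_def min_def)
  then have \<alpha>1: "\<alpha> \<le> 1" by simp
  define E where "E x y = \<alpha> * integral {0..y} (\<lambda>t. k0 (q2 t)) - \<beta> * integral {x..1} (\<lambda>t. h0 (q1 t))" for x y
  have E_step: "E x' y = E x y + \<beta> * integral {x..x'} (\<lambda>t. h0 (q1 t))" if "x \<le> x'" "x' \<le> 1" for x x' y
    using lc_comp_combine[OF lc1, of h0 x x' 1] that by (simp add: E_def h0_def tent_continuous algebra_simps)
  have k0_nonneg: "0 \<le> integral {s..u} (\<lambda>t. k0 (q2 t))" for s u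
    by (intro integral_nonneg I2) (simp add: k0_def tent_nonneg)
  have E_left: "\<bar>E x y\<bar> \<le> slack q1 q2 x y" if xy: "0 \<le> x" "x \<le> a" "0 \<le> y" "y \<le> 1" for x y
  proof -
    have "integral {0..x} (\<lambda>t. h0 (q1 t)) = (x - 0) * 0"
      using xy order by (intro integral_eq_const I1 h0_out) auto
    then have "integral {x..1} (\<lambda>t. h0 (q1 t)) = \<alpha>"
      using lc_comp_combine[OF lc1, of h0 0 x 1] xy order by (simp add: h0_def tent_continuous \<alpha>_def)
    moreover have "\<beta> = integral {0..y} (\<lambda>t. k0 (q2 t)) + integral {y..1} (\<lambda>t. k0 (q2 t))"
      using lc_comp_combine[OF lc2, of k0 0 y 1] xy by (simp add: k0_def tent_continuous \<beta>_def)
    \<comment> \<open>To the left of the gap the whole mass of \<open>h\<close> lies beyond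
      \<open>x\<close>, so only the tail of \<open>k\<close> after \<open>y\<close> remains.\<close>
    ultimately have "E x y = - (\<alpha> * integral {y..1} (\<lambda>t. k0 (q2 t)))"
      by (simp add: E_def algebra_simps)
    moreover have "\<alpha> * integral {y..1} (\<lambda>t. k0 (q2 t)) \<le> 1 * integral {y..1} (\<lambda>t. k0 (q2 t))"
      using \<alpha>1 k0_nonneg by (intro mult_right_mono) auto
    moreover have "integral {y..1} (\<lambda>t. k0 (q2 t)) \<le> slack q1 q2 x y"
      using tail_left[OF xy] by (simp add: k0_def)
    ultimately show ?thesis
      using \<alpha> k0_nonneg[of y 1] by simp
  qed
  have E_right: "\<bar>E x y\<bar> \<le> slack q1 q2 x y" if xy: "b \<le> x" "x \<le> 1" "0 \<le> y" "y \<le> 1" for x y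
  proof -
    have "integral {x..1} (\<lambda>t. h0 (q1 t)) = (1 - x) * 0"
      using xy order by (intro integral_eq_const I1 h0_out) auto
    then have "E x y = \<alpha> * integral {0..y} (\<lambda>t. k0 (q2 t))"
      by (simp add: E_def)
    moreover have "\<alpha> * integral {0..y} (\<lambda>t. k0 (q2 t)) \<le> 1 * integral {0..y} (\<lambda>t. k0 (q2 t))"
      using \<alpha>1 k0_nonneg by (intro mult_right_mono) auto
    moreover have "integral {0..y} (\<lambda>t. k0 (q2 t)) \<le> slack q1 q2 x y"
      using tail_right[OF xy] by (simp add: k0_def)
    ultimately show ?thesis
      using \<alpha> k0_nonneg[of 0 y] by simp
  qed
  \<comment> \<open>Between a and b, slack and perturbation are affine in x, so their values at a and b decide.\<close>
  have E_mid: "\<bar>E x y\<bar> \<le> slack q1 q2 x y" if xy: "a < x" "x < b" "0 \<le> y" "y \<le> 1" for x y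
  proof -
    define \<theta> where "\<theta> = (x - a) / (b - a)"
    have \<theta>: "0 \<le> \<theta>" "\<theta> \<le> 1"
      using xy by (simp_all add: \<theta>_def)
    have \<theta>x: "x - a = \<theta> * (b - a)"
      using order by (simp add: \<theta>_def)
    have S: "slack q1 q2 z y = slack q1 q2 a y + (z - a) * (w - (1 - y))" if "a < z" "z \<le> b" for z
    proof -
      have "integral {a..z} (\<lambda>t. q1 t - (1 - y)) = (z - a) * (w - (1 - y))"
        using that const by (intro integral_eq_const integrable1) auto
      then show ?thesis
        using slack_diff_x[of a z y] that order by simp
    qed
    have EE: "E z y = E a y + (z - a) * (\<beta> * h0 w)" if "a < z" "z \<le> b" for z
    proof -
      have "integral {a..z} (\<lambda>t. h0 (q1 t)) = (z - a) * h0 w"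
        using that const by (intro integral_eq_const I1) auto
      then show ?thesis
        using E_step[of a z y] that order by simp
    qed
    have "slack q1 q2 x y = (1 - \<theta>) * slack q1 q2 a y + \<theta> * slack q1 q2 b y"
      unfolding S[OF xy(1) less_imp_le[OF xy(2)]] S[OF order(2) order_refl] \<theta>x by algebra
    moreover have "E x y = (1 - \<theta>) * E a y + \<theta> * E b y"
      unfolding EE[OF xy(1) less_imp_le[OF xy(2)]] EE[OF order(2) order_refl] \<theta>x by algebra
    moreover have "\<bar>(1 - \<theta>) * E a y + \<theta> * E b y\<bar> \<le> (1 - \<theta>) * \<bar>E a y\<bar> + \<theta> * \<bar>E b y\<bar>"
      using \<theta> abs_triangle_ineq[of "(1 - \<theta>) * E a y" "\<theta> * E b y"] by (simp add: abs_mult)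
    moreover have "(1 - \<theta>) * \<bar>E a y\<bar> + \<theta> * \<bar>E b y\<bar> \<le> (1 - \<theta>) * slack q1 q2 a y + \<theta> * slack q1 q2 b y"
      using \<theta> E_left[of a y] E_right[of b y] xy order by (intro add_mono mult_left_mono) auto
    ultimately show ?thesis
      by linarith
  qed
  have E_bound: "\<bar>E x y\<bar> \<le> 1 * slack q1 q2 x y" if "x \<in> {0..1}" "y \<in> {0..1}" for x y
    using E_left[of x y] E_mid[of x y] E_right[of x y] that by (cases "x \<le> a"; cases "x < b") auto
  have "h0 0 = 0" "h0 1 = 0" "k0 0 = 0" "k0 1 = 0"
    using order by (simp_all add: h0_def k0_def tent_eq_0)
  moreover have "(\<bar>\<beta>\<bar> * 1)-lipschitz_on UNIV h" "(\<bar>\<alpha>\<bar> * 1)-lipschitz_on UNIV k"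
    unfolding h_def k_def h0_def k0_def by (rule lipschitz_on_cmult_real[OF tent_lipschitz])+
  moreover have "integral {0..1} (\<lambda>x. h (q1 x)) = integral {0..1} (\<lambda>x. k (q2 x))"
    by (simp add: h_def k_def flip: \<alpha>_def \<beta>_def)
  moreover have "\<bar>integral {0..y} (\<lambda>x. k (q2 x)) - integral {x..1} (\<lambda>x. h (q1 x))\<bar> \<le> 1 * slack q1 q2 x y"
    if "0 \<le> x" "x \<le> 1" "0 \<le> y" "y \<le> 1" for x y
    using E_bound[of x y] that by (simp add: E_def h_def k_def)
  ultimately have "admissible q1 q2 h k"
    by (intro admissibleI[where C = 1]) (auto simp: h_def k_def)
  moreover have "\<forall>t\<in>{a<..<b}. h (q1 t) \<noteq> 0"
    using h0 \<beta> by (simp add: h_def less_imp_neq[symmetric])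
  moreover have "\<forall>t\<in>{0..1} - {a<..b}. h (q1 t) = 0"
    using h0_out by (auto simp: h_def)
  ultimately show ?thesis
    by blast
qed

section \<open>Perturbations of one function alone\<close>

text \<open>For \<open>y \<le> 1 - p\<close> the slack is bounded away from 0. For larger \<open>y\<close> it grows in \<open>x\<close> at rate
  at least \<open>q1 - p\<close> once \<open>q1\<close> exceeds \<open>p\<close>, which is where the tent starts to contribute.\<close>

lemma left_bound:
  assumes p: "1 - d < p" "p \<le> 1" and e: "a \<le> e" "e < b"
  obtains C where "0 \<le> C" "\<And>x y. 0 \<le> x \<Longrightarrow> x \<le> e \<Longrightarrow> 0 \<le> y \<Longrightarrow> y \<le> 1 \<Longrightarrow>
    integral {0..x} (\<lambda>t. tent p r (q1 t)) \<le> C * slack q1 q2 x y"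
proof -
  have p0: "0 \<le> p"
    using p order by simp
  \<comment> \<open>For \<open>a \<le> x \<le> e < b\<close> a zero would need \<open>x = a\<close>
    and \<open>d \<le> y\<close>, but here \<open>y \<le> 1 - p < d\<close>.\<close>
  obtain \<kappa> where \<kappa>: "0 < \<kappa>"
    "\<And>x y. a \<le> x \<Longrightarrow> x \<le> e \<Longrightarrow> 0 \<le> y \<Longrightarrow> y \<le> 1 - p \<Longrightarrow> \<kappa> \<le> slack q1 q2 x y"
  proof (rule slack_bounded_below[of a e 0 "1 - p"])
    fix x y assume "a \<le> x" "x \<le> e" "0 \<le> y" "y \<le> 1 - p"
    then show "slack q1 q2 x y \<noteq> 0"
      using zeroD[of x y] p p0 e order by auto
  qed (use order e p0 in auto)
  obtain z where z: "0 \<le> z" "z \<le> 1" "\<And>t. 0 \<le> t \<Longrightarrow> t \<le> z \<Longrightarrow> q1 t \<le> p" "\<And>t. z < t \<Longrightarrow> t \<le> 1 \<Longrightarrow> p < q1 t"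
    using lc_threshold[OF lc1 p0] by metis
  \<comment> \<open>Both \<open>1 \<le> C\<close> and \<open>1 \<le> C * \<kappa>\<close> hold,
    which serves the growth estimate and the lower bound \<open>\<kappa>\<close> alike.\<close>
  define C where "C = 1 + 1 / \<kappa>"
  have C: "1 \<le> C" "1 \<le> C * \<kappa>"
    using \<kappa>(1) by (simp_all add: C_def field_simps)
  have bound: "integral {0..x} (\<lambda>t. tent p r (q1 t)) \<le> C * slack q1 q2 x y"
    if xy: "0 \<le> x" "x \<le> e" "0 \<le> y" "y \<le> 1" for x y
  proof -
    have x1: "x \<le> 1"
      using xy e order by simp
    have S0: "0 \<le> slack q1 q2 x y"
      using slack_nonneg xy x1 by simp
    \<comment> \<open>Up to \<open>z\<close> the tent vanishes. The last case is void, because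
      \<open>q1 x \<le> 1 - d < p\<close> for \<open>x \<le> a\<close>.\<close>
    consider "x \<le> z" | "a < x" "y \<le> 1 - p" | "z < x" "1 - p < y" | "x \<le> a" "z < x"
      by linarith
    then show ?thesis
    proof cases
      case 1
      have "integral {0..x} (\<lambda>t. tent p r (q1 t)) = (x - 0) * 0"
        using xy 1 z by (intro integral_eq_const integrable_tent1 tent_eq_0) auto
      then show ?thesis
        using C S0 by simp
    next
      case 2
      have "tent p r (q1 t) \<le> 1" for t
        using lc_range[OF lc1, of t] p0 by (auto simp: tent_def)
      then have "integral {0..x} (\<lambda>t. tent p r (q1 t)) \<le> (x - 0) * 1"
        using xy by (intro integral_le_const integrable_tent1) auto
      also have "\<dots> \<le> C * \<kappa>"
        using x1 C by simp
      also have "\<dots> \<le> C * slack q1 q2 x y"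
        using \<kappa>(2)[of x y] 2 xy C by (intro mult_left_mono) auto
      finally show ?thesis .
    next
      case 3
      have "integral {0..z} (\<lambda>t. tent p r (q1 t)) = (z - 0) * 0"
        using z by (intro integral_eq_const integrable_tent1 tent_eq_0) auto
      then have "integral {0..x} (\<lambda>t. tent p r (q1 t)) = integral {z..x} (\<lambda>t. tent p r (q1 t))"
        using lc_comp_combine[OF lc1 tent_continuous, of 0 z x p r] z 3 by simp
      also have "\<dots> \<le> integral {z..x} (\<lambda>t. q1 t - (1 - y))"
      proof (intro integral_le_interior integrable_tent1 integrable1)
        fix t assume "z < t" "t < x"
        then have "p < q1 t"
          using z x1 by simp
        then show "tent p r (q1 t) \<le> q1 t - (1 - y)"
          using tent_le1[of p "q1 t" r] 3 by simp
      qed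
      also have "\<dots> = slack q1 q2 x y - slack q1 q2 z y"
        using slack_diff_x[of z x y] z 3 x1 by simp
      also have "\<dots> \<le> slack q1 q2 x y"
        using slack_nonneg[of z y] z xy by simp
      also have "\<dots> \<le> C * slack q1 q2 x y"
        using mult_right_mono[OF C(1) S0] by simp
      finally show ?thesis .
    next
      case 4
      then show ?thesis
        using z(4)[of x] below[of x] p xy x1 by simp
    qed
  qed
  have "0 \<le> C"
    using C by simp
  then show ?thesis
    using bound by (rule that)
qed

text \<open>For \<open>1 - r \<le> y\<close> compactness bounds the slack away from 0 on
  \<open>{e..b}\<close>. For smaller \<open>y\<close> the slack falls in \<open>x\<close> at rate at
  least \<open>r - q1\<close> as long as \<open>q1 \<le> r\<close>, and \<open>r - q1\<close>
  dominates the tent there.\<close>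

lemma right_bound:
  assumes r: "r < 1 - c" "0 \<le> r" and p: "0 \<le> p" and e: "a < e" "e \<le> b"
  obtains C where "0 \<le> C" "\<And>x y. e \<le> x \<Longrightarrow> x \<le> 1 \<Longrightarrow> 0 \<le> y \<Longrightarrow> y \<le> 1 \<Longrightarrow>
    integral {x..1} (\<lambda>t. tent p r (q1 t)) \<le> C * slack q1 q2 x y"
proof -
  have r1: "r \<le> 1"
    using r order by simp
  obtain \<kappa> where \<kappa>: "0 < \<kappa>"
    "\<And>x y. e \<le> x \<Longrightarrow> x \<le> b \<Longrightarrow> 1 - r \<le> y \<Longrightarrow> y \<le> 1 \<Longrightarrow> \<kappa> \<le> slack q1 q2 x y"
  proof (rule slack_bounded_below[of e b "1 - r" 1])
    fix x y assume "e \<le> x" "x \<le> b" "1 - r \<le> y" "y \<le> 1"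
    then show "slack q1 q2 x y \<noteq> 0"
      using zeroD[of x y] r r1 e order by auto
  qed (use order e r1 in auto)
  obtain z where z: "0 \<le> z" "z \<le> 1" "\<And>t. 0 \<le> t \<Longrightarrow> t \<le> z \<Longrightarrow> q1 t \<le> r" "\<And>t. z < t \<Longrightarrow> t \<le> 1 \<Longrightarrow> r < q1 t"
    using lc_threshold[OF lc1 r(2)] by metis
  define C where "C = 1 + 1 / \<kappa>"
  have C: "1 \<le> C" "1 \<le> C * \<kappa>"
    using \<kappa>(1) by (simp_all add: C_def field_simps)
  have bound: "integral {x..1} (\<lambda>t. tent p r (q1 t)) \<le> C * slack q1 q2 x y"
    if xy: "e \<le> x" "x \<le> 1" "0 \<le> y" "y \<le> 1" for x y
  proof -
    have x0: "0 \<le> x"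
      using xy e order by simp
    have S0: "0 \<le> slack q1 q2 x y"
      using slack_nonneg xy x0 by simp
    have above_z: "tent p r (q1 t) = 0" if "z < t" "t \<le> 1" for t
      using z(4)[OF that] by (intro tent_eq_0) auto
    consider "z \<le> x" | "x < b" "1 - r \<le> y" | "x < z" "y < 1 - r" | "b \<le> x" "x < z"
      by linarith
    then show ?thesis
    proof cases
      case 1
      have "integral {x..1} (\<lambda>t. tent p r (q1 t)) = (1 - x) * 0"
        using xy 1 by (intro integral_eq_const integrable_tent1 above_z) auto
      then show ?thesis
        using C S0 by simp
    next
      case 2
      have "tent p r (q1 t) \<le> 1" for t
        using lc_range[OF lc1, of t] p by (auto simp: tent_def)
      then have "integral {x..1} (\<lambda>t. tent p r (q1 t)) \<le> (1 - x) * 1"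
        using xy by (intro integral_le_const integrable_tent1) auto
      also have "\<dots> \<le> C * \<kappa>"
        using x0 C by simp
      also have "\<dots> \<le> C * slack q1 q2 x y"
        using \<kappa>(2)[of x y] 2 xy C by (intro mult_left_mono) auto
      finally show ?thesis .
    next
      case 3
      have "integral {z..1} (\<lambda>t. tent p r (q1 t)) = (1 - z) * 0"
        using z by (intro integral_eq_const integrable_tent1 above_z) auto
      then have "integral {x..1} (\<lambda>t. tent p r (q1 t)) = integral {x..z} (\<lambda>t. tent p r (q1 t))"
        using lc_comp_combine[OF lc1 tent_continuous, of x z 1 p r] z 3 by simp
      also have "\<dots> \<le> integral {x..z} (\<lambda>t. - (q1 t - (1 - y)))"
      proof (intro integral_le_interior integrable_tent1 integrable_neg integrable1)
        fix t assume "x < t" "t < z"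
        then have "q1 t \<le> r"
          using z x0 by simp
        then show "tent p r (q1 t) \<le> - (q1 t - (1 - y))"
          using tent_le2[of "q1 t" r p] 3 by simp
      qed
      also have "\<dots> = - integral {x..z} (\<lambda>t. q1 t - (1 - y))"
        by (rule integral_neg)
      also have "\<dots> = slack q1 q2 x y - slack q1 q2 z y"
        using slack_diff_x[of x z y] z 3 x0 by simp
      also have "\<dots> \<le> slack q1 q2 x y"
        using slack_nonneg[of z y] z xy by simp
      also have "\<dots> \<le> C * slack q1 q2 x y"
        using mult_right_mono[OF C(1) S0] by simp
      finally show ?thesis .
    next
      case 4
      then have "q1 z \<le> r" "1 - c \<le> q1 z"
        using z above[of z] by auto
      then show ?thesis
        using r by simp
    qed
  qed
  have "0 \<le> C"
    using C by simp
  then show ?thesis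
    using bound by (rule that)
qed

text \<open>Two different values of \<open>q1\<close> leave room for two adjacent bumps of opposite
  sign whose total mass is 0, so \<open>q2\<close> can stay fixed.\<close>

lemma nonconst_perturbation:
  assumes x1: "a < x1" "x1 < b" and x2: "a < x2" "x2 < b" and less: "q1 x1 < q1 x2"
  obtains h where "admissible q1 q2 h (\<lambda>_. 0)" "h (q1 x1) \<noteq> 0"
proof -
  \<comment> \<open>The levels \<open>p < q1 x1 < s < q1 x2 < r\<close> lie strictly between
    \<open>1 - d\<close> and \<open>1 - c\<close>, as the two bounds on the slack require.\<close>
  define p where "p = (1 - d + q1 x1) / 2"
  define s where "s = (q1 x1 + q1 x2) / 2"
  define r where "r = (q1 x2 + (1 - c)) / 2"
  have lev: "1 - d < p" "p < q1 x1" "q1 x1 < s" "s < q1 x2" "q1 x2 < r" "r < 1 - c"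
    using inside(1)[OF x1] inside(2)[OF x2] less by (simp_all add: p_def s_def r_def)
  have p01: "0 \<le> p" "p \<le> 1" "0 \<le> s" "s \<le> 1" "0 \<le> r" "r \<le> 1"
    using lev order by simp_all
  define \<alpha> where "\<alpha> = integral {0..1} (\<lambda>t. tent p s (q1 t))"
  define \<beta> where "\<beta> = integral {0..1} (\<lambda>t. tent s r (q1 t))"
  have \<alpha>0: "0 < \<alpha>"
    unfolding \<alpha>_def using lev x1 order
    by (intro lc_comp_integral_pos[OF lc1 tent_continuous, of _ _ x1]) (auto simp: tent_nonneg intro: tent_pos)
  have \<beta>0: "0 < \<beta>"
    unfolding \<beta>_def using lev x2 order
    by (intro lc_comp_integral_pos[OF lc1 tent_continuous, of _ _ x2]) (auto simp: tent_nonneg intro: tent_pos)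
  have le1: "tent u v (q1 t) \<le> 1" if "0 \<le> u" for u v t
    using lc_range[OF lc1, of t] that by (auto simp: tent_def)
  have "\<alpha> \<le> (1 - 0) * 1" "\<beta> \<le> (1 - 0) * 1"
    unfolding \<alpha>_def \<beta>_def using p01 by (auto intro!: integral_le_const[where K = 1 and s = 0 and t = 1, simplified] integrable_tent1 le1)
  then have \<alpha>1: "\<alpha> \<le> 1" and \<beta>1: "\<beta> \<le> 1"
    by simp_all
  \<comment> \<open>The weights \<open>\<beta>\<close> and \<open>- \<alpha>\<close> cancel the
    masses, and the factors at most 1 keep \<open>\<bar>h\<bar>\<close> below a single tent on
    \<open>p\<close> to \<open>r\<close>.\<close>
  define h where "h v = \<beta> * tent p s v + - \<alpha> * tent s r v" for v
  have h_abs: "\<bar>h v\<bar> \<le> tent p r v" for v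
  proof -
    have "\<bar>h v\<bar> \<le> \<beta> * tent p s v + \<alpha> * tent s r v"
      using \<alpha>0 \<beta>0 abs_triangle_ineq[of "\<beta> * tent p s v" "- \<alpha> * tent s r v"]
      by (simp add: h_def abs_mult tent_nonneg)
    also have "\<dots> \<le> 1 * tent p s v + 1 * tent s r v"
      using \<alpha>1 \<beta>1 by (intro add_mono mult_right_mono tent_nonneg)
    also have "\<dots> \<le> tent p r v"
      using lev by (auto simp: tent_def)
    finally show ?thesis .
  qed
  have lip: "(\<bar>\<beta>\<bar> * 1 + \<bar>- \<alpha>\<bar> * 1)-lipschitz_on UNIV h"
    unfolding h_def by (intro lipschitz_on_add lipschitz_on_cmult_real tent_lipschitz)
  have I: "(\<lambda>t. h (q1 t)) integrable_on {u..w}" for u w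
    by (rule lc_comp_lipschitz_integrable[OF lc1 lip])
  have "integral {0..1} (\<lambda>t. h (q1 t)) = integral {0..1} (\<lambda>t. \<beta> * tent p s (q1 t)) + integral {0..1} (\<lambda>t. - \<alpha> * tent s r (q1 t))"
    unfolding h_def
    by (intro Henstock_Kurzweil_Integration.integral_add integrable_on_mult_right integrable_tent1)
  also have "\<dots> = 0"
    using \<alpha>_def \<beta>_def by simp
  finally have zero: "integral {0..1} (\<lambda>t. h (q1 t)) = 0" .
  have abs_le: "\<bar>integral {u..w} (\<lambda>t. h (q1 t))\<bar> \<le> integral {u..w} (\<lambda>t. tent p r (q1 t))" for u w
    using integral_norm_bound_integral[OF I integrable_tent1] h_abs by simp
  define e where "e = (a + b) / 2"
  have e: "a \<le> e" "e < b" "a < e" "e \<le> b"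
    using order by (simp_all add: e_def)
  obtain C1 where C1: "0 \<le> C1" "\<And>x y. 0 \<le> x \<Longrightarrow> x \<le> e \<Longrightarrow> 0 \<le> y \<Longrightarrow> y \<le> 1 \<Longrightarrow>
      integral {0..x} (\<lambda>t. tent p r (q1 t)) \<le> C1 * slack q1 q2 x y"
    using left_bound[OF lev(1) p01(2) e(1,2)] by metis
  obtain C2 where C2: "0 \<le> C2" "\<And>x y. e \<le> x \<Longrightarrow> x \<le> 1 \<Longrightarrow> 0 \<le> y \<Longrightarrow> y \<le> 1 \<Longrightarrow>
      integral {x..1} (\<lambda>t. tent p r (q1 t)) \<le> C2 * slack q1 q2 x y"
    using right_bound[OF lev(6) p01(5,1) e(3,4)] by metis
  have bound: "\<bar>integral {0..y} (\<lambda>t. 0) - integral {x..1} (\<lambda>t. h (q1 t))\<bar> \<le> (C1 + C2) * slack q1 q2 x y"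
    if xy: "0 \<le> x" "x \<le> 1" "0 \<le> y" "y \<le> 1" for x y
  proof -
    \<comment> \<open>Since the total mass is 0, the integral over \<open>{x..1}\<close> can be
      traded for the one over \<open>{0..x}\<close> when \<open>x\<close> is at most
      \<open>e\<close>.\<close>
    have comb: "integral {0..x} (\<lambda>t. h (q1 t)) + integral {x..1} (\<lambda>t. h (q1 t)) = 0"
      using Henstock_Kurzweil_Integration.integral_combine[OF xy(1,2) I] zero by simp
    have nn: "0 \<le> C1 * slack q1 q2 x y" "0 \<le> C2 * slack q1 q2 x y"
      using C1 C2 slack_nonneg[OF xy] by simp_all
    show ?thesis
    proof (cases "x \<le> e")
      case True
      then show ?thesis
        using comb abs_le[of 0 x] C1(2)[of x y] xy nn by (simp add: distrib_right)
    next
      case False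
      then show ?thesis
        using abs_le[of x 1] C2(2)[of x y] xy nn by (simp add: distrib_right)
    qed
  qed
  have "h 0 = 0" "h 1 = 0"
    using p01 by (simp_all add: h_def tent_eq_0)
  then have "admissible q1 q2 h (\<lambda>_. 0)"
    using zero bound by (intro admissibleI[OF lip lipschitz_on_constant]) auto
  moreover have "h (q1 x1) \<noteq> 0"
    using lev \<beta>0 tent_pos[of p "q1 x1" s] by (simp add: h_def tent_eq_0)
  ultimately show ?thesis
    using that by blast
qed

end

section \<open>Extreme points\<close>

context feasible_pair
begin

lemma rank_one_swap:
  assumes "rank_one q1 q2"
  shows "rank_one q2 q1"
  unfolding rank_one_def
proof (intro allI impI)
  fix k h k' h'
  assume "admissible q2 q1 k h" "admissible q2 q1 k' h'"
  then have "admissible q1 q2 h k" "admissible q1 q2 h' k'"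
    by (auto intro: admissible_swap)
  then show "\<exists>s s'. (s \<noteq> 0 \<or> s' \<noteq> 0) \<and>
      (\<forall>x. s * k (q2 x) + s' * k' (q2 x) = 0 \<and> s * h (q1 x) + s' * h' (q1 x) = 0)"
    using assms unfolding rank_one_def by meson
qed

text \<open>By compactness there are nearest zeros on either side of \<open>x0\<close>. Taking the
  lowest zero over \<open>a\<close> and the highest over \<open>b\<close>, the antitone order of the
  zeros leaves none in between.\<close>

lemma ex_gap:
  assumes x0: "0 \<le> x0" "x0 \<le> 1" and "\<forall>y\<in>{0..1}. slack q1 q2 x0 y \<noteq> 0"
  shows "\<exists>a b c d. gap q1 q2 a b c d \<and> a < x0 \<and> x0 < b"
proof -
  have pos: "slack q1 q2 x0 y \<noteq> 0" if "0 \<le> y" "y \<le> 1" for y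
    using assms(3) that by simp
  define Z where "Z = {p \<in> {0..1} \<times> {0..1}. slack q1 q2 (fst p) (snd p) = 0}"
  have Z_iff: "(x, y) \<in> Z \<longleftrightarrow> x \<in> {0..1} \<and> y \<in> {0..1} \<and> slack q1 q2 x y = 0" for x y
    by (auto simp: Z_def)
  have "compact Z"
  proof -
    have "closed Z"
      unfolding Z_def by (intro continuous_closed_preimage_constant continuous_slack closed_Times) auto
    moreover have "bounded Z"
      by (rule bounded_subset[of "{0..1} \<times> {0..1}"]) (auto simp: Z_def intro: bounded_Times)
    ultimately show ?thesis
      by (simp add: compact_eq_bounded_closed)
  qed
  have corners: "(0, 1) \<in> Z" "(1, 0) \<in> Z"
    using mass by (simp_all add: Z_iff slack_def)
  have compact_slice: "compact (fst ` (Z \<inter> (U \<times> UNIV)))" "compact (snd ` (Z \<inter> (U \<times> UNIV)))"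
    if "closed U" for U :: "real set"
    using that \<open>compact Z\<close>
    by (intro compact_continuous_image continuous_intros compact_Int_closed closed_Times; simp)+
  have "0 \<in> fst ` (Z \<inter> ({..x0} \<times> UNIV))" "1 \<in> fst ` (Z \<inter> ({x0..} \<times> UNIV))"
    using corners x0 by force+
  then have ne: "fst ` (Z \<inter> ({..x0} \<times> UNIV)) \<noteq> {}" "fst ` (Z \<inter> ({x0..} \<times> UNIV)) \<noteq> {}"
    by blast+
  obtain a where a: "a \<in> fst ` (Z \<inter> ({..x0} \<times> UNIV))" and a_max: "\<forall>x \<in> fst ` (Z \<inter> ({..x0} \<times> UNIV)). x \<le> a"
    using compact_attains_sup[OF compact_slice(1)[OF closed_atMost] ne(1)] by auto
  obtain b where b: "b \<in> fst ` (Z \<inter> ({x0..} \<times> UNIV))" and b_min: "\<forall>x \<in> fst ` (Z \<inter> ({x0..} \<times> UNIV)). b \<le> x"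
    using compact_attains_inf[OF compact_slice(1)[OF closed_atLeast] ne(2)] by auto
  have ne': "snd ` (Z \<inter> ({a} \<times> UNIV)) \<noteq> {}" "snd ` (Z \<inter> ({b} \<times> UNIV)) \<noteq> {}"
    using a b by force+
  obtain d where d: "d \<in> snd ` (Z \<inter> ({a} \<times> UNIV))" and d_min: "\<forall>y \<in> snd ` (Z \<inter> ({a} \<times> UNIV)). d \<le> y"
    using compact_attains_inf[OF compact_slice(2)[OF closed_singleton] ne'(1)] by auto
  obtain c where c: "c \<in> snd ` (Z \<inter> ({b} \<times> UNIV))" and c_max: "\<forall>y \<in> snd ` (Z \<inter> ({b} \<times> UNIV)). y \<le> c"
    using compact_attains_sup[OF compact_slice(2)[OF closed_singleton] ne'(2)] by auto
  have ad: "(a, d) \<in> Z" and bc: "(b, c) \<in> Z"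
    using d c by auto
  have ax: "a < x0" and xb: "x0 < b"
    using a b pos by (auto simp: Z_iff less_le)
  have a_max': "x \<le> a" if "(x, y) \<in> Z" "x \<le> x0" for x y
    using a_max that by force
  have b_min': "b \<le> x" if "(x, y) \<in> Z" "x0 \<le> x" for x y
    using b_min that by force
  have d_min': "d \<le> y" if "(a, y) \<in> Z" for y
    using d_min that by force
  have c_max': "y \<le> c" if "(b, y) \<in> Z" for y
    using c_max that by force
  have cross: "(x - x') * (y - y') \<le> 0" if "(x, y) \<in> Z" "(x', y') \<in> Z" for x y x' y'
    using slack_cross that by (auto simp: Z_iff)
  have zero: "x \<le> a \<and> d \<le> y \<or> b \<le> x \<and> y \<le> c" if xy: "(x, y) \<in> Z" for x y
  proof -
    consider "x < a" | "x = a" | "x = b" | "b < x"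
      using a_max'[OF xy] b_min'[OF xy] by linarith
    then show ?thesis
    proof cases
      case 1
      then show ?thesis
        using cross[OF xy ad] by (auto simp: mult_le_0_iff)
    next
      case 2
      then show ?thesis
        using d_min' xy by auto
    next
      case 3
      then show ?thesis
        using c_max' xy by auto
    next
      case 4
      then show ?thesis
        using cross[OF xy bc] by (auto simp: mult_le_0_iff)
    qed
  qed
  have unit: "0 \<le> a" "b \<le> 1" "0 \<le> c" "c \<le> 1" "0 \<le> d" "d \<le> 1" and S: "slack q1 q2 a d = 0" "slack q1 q2 b c = 0"
    using ad bc by (auto simp: Z_iff)
  \<comment> \<open>If \<open>c = d\<close>, the slack at height \<open>c\<close> vanishes at
    \<open>a\<close> and \<open>b\<close>. Being convex in \<open>x\<close> it cannot be positive at
    \<open>x0\<close> in between.\<close>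
  have "c \<noteq> d"
  proof
    assume eq: "c = d"
    have "0 < slack q1 q2 x0 c"
      using slack_nonneg[of x0 c] pos[of c] x0 unit by simp
    then have "0 < integral {a..x0} (\<lambda>t. q1 t - (1 - c))"
      using slack_diff_x[of a x0 c] S eq ax x0 unit by simp
    moreover have "integral {a..x0} (\<lambda>t. q1 t - (1 - c)) \<le> (x0 - a) * (q1 x0 - (1 - c))"
      using lc_mono[OF lc1, of _ x0] ax x0 unit by (intro integral_le_const integrable1) auto
    ultimately have "0 < (x0 - a) * (q1 x0 - (1 - c))"
      by linarith
    then have "0 < q1 x0 - (1 - c)"
      using ax by (simp add: zero_less_mult_iff)
    then have "0 \<le> q1 t - (1 - c)" if "x0 < t" "t < b" for t
      using lc_mono[OF lc1, of x0 t] that x0 unit by simp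
    then have "(b - x0) * 0 \<le> integral {x0..b} (\<lambda>t. q1 t - (1 - c))"
      using xb by (intro integral_ge_const integrable1) auto
    then have "slack q1 q2 x0 c \<le> 0"
      using slack_diff_x[of x0 b c] S xb x0 unit by simp
    then show False
      using \<open>0 < slack q1 q2 x0 c\<close> by simp
  qed
  moreover have "c \<le> d"
    using cross[OF ad bc] ax xb by (auto simp: mult_le_0_iff)
  ultimately have "gap q1 q2 a b c d"
    using unit S ax xb zero by (auto simp: gap_def Z_iff)
  then show ?thesis
    using ax xb by blast
qed

text \<open>Each zero \<open>(x, y)\<close> places \<open>q1\<close> and \<open>q2\<close> on
  opposite sides of a common corner. Zeros approaching \<open>z\<close> from the left determine
  \<open>q1 z\<close>, by left continuity.\<close>

lemma eq_conjugate:
  assumes z: "0 < z" "z \<le> 1"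
    and zeros: "\<And>u. u < z \<Longrightarrow> \<exists>x\<ge>0. u < x \<and> x < z \<and> (\<exists>y\<in>{0..1}. slack q1 q2 x y = 0)"
  shows "q1 z = conjugate q2 z"
proof -
  have q2_le: "q2 t \<le> 1 - x" if "slack q1 q2 x y = 0" "0 \<le> x" "x < z" "0 \<le> y" "y \<le> 1" "0 \<le> t" "t \<le> y" for x y t
    using feasible_pair.zero_le[OF swap, of y x t] slack_swap[of x y] that z by simp
  have q2_ge: "1 - x \<le> q2 t" if "slack q1 q2 x y = 0" "0 \<le> x" "x < z" "0 \<le> y" "y < t" "t \<le> 1" for x y t
    using feasible_pair.zero_ge[OF swap, of y x t] slack_swap[of x y] that z by simp
  obtain y0 where y0: "0 \<le> y0" "y0 \<le> 1" "\<And>t. 0 \<le> t \<Longrightarrow> t \<le> y0 \<Longrightarrow> q2 t \<le> 1 - z"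
      "\<And>t. y0 < t \<Longrightarrow> t \<le> 1 \<Longrightarrow> 1 - z < q2 t"
    using lc_threshold[OF lc2, of "1 - z"] z by auto
  have conj: "conjugate q2 z = 1 - y0"
    by (rule conjugate_threshold[OF lc2 y0(1,2) z(2) y0(3,4)])
  have "q1 z \<le> 1 - y0"
  proof (rule lc_leI[OF lc1 order_refl z])
    fix t assume t: "0 < t" "t < z"
    obtain x y where xy: "t < x" "x < z" "0 \<le> x" "0 \<le> y" "y \<le> 1" "slack q1 q2 x y = 0"
      using zeros[OF t(2)] by auto
    \<comment> \<open>Beyond \<open>y\<close> the zero gives \<open>q2 \<ge> 1 - x > 1 - z\<close>,
      while \<open>q2 y0 \<le> 1 - z\<close>.\<close>
    have "y0 \<le> y"
    proof (rule ccontr)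
      assume "\<not> y0 \<le> y"
      then have "1 - x \<le> q2 y0"
        using xy y0 by (intro q2_ge[of x y]) auto
      then show False
        using y0(3)[of y0] y0(1) xy by simp
    qed
    then show "q1 t \<le> 1 - y0"
      using zero_le[of x y t] xy t z by simp
  qed
  moreover have "1 - y0 \<le> q1 z"
  proof (rule ccontr)
    assume "\<not> 1 - y0 \<le> q1 z"
    then have lt: "y0 < 1 - q1 z" by simp
    \<comment> \<open>Past the threshold \<open>y0\<close> one has \<open>q2 t0 > 1 - z\<close>, so
      a zero with \<open>x > 1 - q2 t0\<close> exists. Its height is at least \<open>t0\<close>,
      which forces \<open>q2 t0 \<le> 1 - x\<close>.\<close>
    define t0 where "t0 = 1 - q1 z"
    have t0: "y0 < t0" "0 \<le> t0" "t0 \<le> 1"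
      using lt lc_range[OF lc1, of z] by (simp_all add: t0_def)
    then have "1 - q2 t0 < z"
      using y0(4)[of t0] by simp
    then obtain x y where xy: "1 - q2 t0 < x" "x < z" "0 \<le> x" "0 \<le> y" "y \<le> 1" "slack q1 q2 x y = 0"
      using zeros[of "1 - q2 t0"] by auto
    have "1 - y \<le> q1 z"
      using zero_ge[of x y z] xy z by simp
    then have "q2 t0 \<le> 1 - x"
      using xy t0 by (intro q2_le[of x y]) (auto simp: t0_def)
    then show False
      using xy by simp
  qed
  ultimately show ?thesis
    using conj by simp
qed

end

section \<open>Uniqueness of the gap and constancy on it\<close>

context gap_pair
begin

text \<open>If \<open>q1\<close> is constant and \<open>q2\<close> is not, the mass-changing pair
  moves \<open>q1\<close> while another pair moves \<open>q2\<close> alone; these are independent.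
  Exchanging the two points gives equality.\<close>

lemma const_dual:
  assumes rank: "rank_one q1 q2" and const: "\<forall>t\<in>{a<..<b}. q1 t = w"
    and y1: "c < y1" "y1 < d" and y2: "c < y2" "y2 < d"
  shows "q2 y1 \<le> q2 y2"
proof (rule ccontr)
  assume "\<not> q2 y1 \<le> q2 y2"
  then obtain k' where k': "admissible q2 q1 k' (\<lambda>_. 0)" "k' (q2 y2) \<noteq> 0"
    using gap_pair.nonconst_perturbation[OF gap_pair_swap y2 y1] by force
  obtain h k where hk: "admissible q1 q2 h k" "\<forall>t\<in>{a<..<b}. h (q1 t) \<noteq> 0"
      "\<forall>t\<in>{0..1} - {a<..b}. h (q1 t) = 0"
    using bulk_perturbation[OF const] by blast
  obtain s s' where ss: "s \<noteq> 0 \<or> s' \<noteq> 0" "\<forall>x. s * h (q1 x) + s' * 0 = 0" "\<forall>x. s * k (q2 x) + s' * k' (q2 x) = 0"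
    using rank_oneD[OF rank hk(1) admissible_swap[OF k'(1)]] by (elim exE conjE)
  have "s = 0"
    using spec[OF ss(2), of "(a + b) / 2"] bspec[OF hk(2), of "(a + b) / 2"] order by simp
  then show False
    using ss(1) spec[OF ss(3), of y2] k'(2) by simp
qed

text \<open>Otherwise one admissible pair moves only \<open>q1\<close> and another only
  \<open>q2\<close>.\<close>

lemma nonconst_both:
  assumes rank: "rank_one q1 q2"
    and x: "a < x1" "x1 < b" "a < x2" "x2 < b" and y: "c < y1" "y1 < d" "c < y2" "y2 < d"
  shows "\<not> (q1 x1 < q1 x2 \<and> q2 y1 < q2 y2)"
proof
  assume less: "q1 x1 < q1 x2 \<and> q2 y1 < q2 y2"
  obtain h where h: "admissible q1 q2 h (\<lambda>_. 0)" "h (q1 x1) \<noteq> 0"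
    using nonconst_perturbation[OF x] less by blast
  obtain k where k: "admissible q2 q1 k (\<lambda>_. 0)" "k (q2 y1) \<noteq> 0"
    using gap_pair.nonconst_perturbation[OF gap_pair_swap y] less by blast
  obtain s s' where ss: "s \<noteq> 0 \<or> s' \<noteq> 0" "\<forall>x. s * h (q1 x) + s' * 0 = 0" "\<forall>x. s * 0 + s' * k (q2 x) = 0"
    using rank_oneD[OF rank h(1) admissible_swap[OF k(1)]] by (elim exE conjE)
  show False
    using ss(1) spec[OF ss(2), of x1] spec[OF ss(3), of y1] h(2) k(2) by simp
qed

end

lemma (in gap_pair) const_both:
  assumes rank: "rank_one q1 q2"
  obtains w m where "\<forall>t\<in>{a<..<b}. q1 t = w" "\<forall>t\<in>{c<..<d}. q2 t = m"
proof -
  define x0 where "x0 = (a + b) / 2"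
  define y0 where "y0 = (c + d) / 2"
  have x0: "a < x0" "x0 < b" and y0: "c < y0" "y0 < d"
    using order by (simp_all add: x0_def y0_def)
  have "(\<forall>t\<in>{a<..<b}. q1 t = q1 x0) \<or> (\<forall>t\<in>{c<..<d}. q2 t = q2 y0)"
  proof (rule ccontr)
    assume "\<not> ?thesis"
    then obtain x1 y1 where "a < x1" "x1 < b" "q1 x1 \<noteq> q1 x0" "c < y1" "y1 < d" "q2 y1 \<noteq> q2 y0"
      by auto
    then show False
      using nonconst_both[OF rank, of x1 x0 y1 y0] nonconst_both[OF rank, of x0 x1 y1 y0]
        nonconst_both[OF rank, of x1 x0 y0 y1] nonconst_both[OF rank, of x0 x1 y0 y1] x0 y0
      by linarith
  qed
  then show ?thesis
  proof
    assume const: "\<forall>t\<in>{a<..<b}. q1 t = q1 x0"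
    have "\<forall>t\<in>{c<..<d}. q2 t = q2 y0"
      using const_dual[OF rank const] y0 by (meson antisym greaterThanLessThan_iff)
    with const show ?thesis
      by (rule that)
  next
    assume const: "\<forall>t\<in>{c<..<d}. q2 t = q2 y0"
    have "\<forall>t\<in>{a<..<b}. q1 t = q1 x0"
      using gap_pair.const_dual[OF gap_pair_swap rank_one_swap[OF rank] const] x0 by (meson antisym greaterThanLessThan_iff)
    then show ?thesis
      using const by (rule that)
  qed
qed

text \<open>A zero-free \<open>x\<close> off this gap would lie in a second gap. The mass-changing
  pairs of the two gaps act on \<open>q1\<close> over disjoint intervals, so they are
  independent.\<close>

lemma (in gap_pair) gap_unique:
  assumes rank: "rank_one q1 q2" and x: "0 \<le> x" "x \<le> 1" "x \<le> a \<or> b \<le> x"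
  shows "\<exists>y\<in>{0..1}. slack q1 q2 x y = 0"
proof (rule ccontr)
  assume no_zero: "\<not> ?thesis"
  then obtain a' b' c' d' where gap': "gap q1 q2 a' b' c' d'" and x': "a' < x" "x < b'"
    using ex_gap[OF x(1,2)] by blast
  have other: "gap_pair q1 q2 a' b' c' d'"
    by unfold_locales (rule gap')
  \<comment> \<open>The end points carry zeros. Strictness matters at \<open>b\<close>, where
    \<open>h (q1 b)\<close> need not vanish.\<close>
  have "x \<noteq> a" "x \<noteq> b"
    using no_zero corner order by auto
  then have far: "x < a \<or> b < x"
    using x by auto
  \<comment> \<open>No zero projects into the open interval of another gap, so neither end point of
    the first gap lies in it.\<close>
  have a: "\<not> (a' < a \<and> a < b')" and b: "\<not> (a' < b \<and> b < b')"
    using gap_pair.zeroD[OF other corner(1)] gap_pair.zeroD[OF other corner(2)] order by auto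
  define x0 where "x0 = (a + b) / 2"
  have x0: "a < x0" "x0 < b" "x0 \<le> a' \<or> b' < x0"
    using far a b x' order by (auto simp: x0_def)
  obtain w m where const: "\<forall>t\<in>{a<..<b}. q1 t = w" "\<forall>t\<in>{c<..<d}. q2 t = m"
    by (rule const_both[OF rank])
  obtain w' m' where const': "\<forall>t\<in>{a'<..<b'}. q1 t = w'" "\<forall>t\<in>{c'<..<d'}. q2 t = m'"
    by (rule gap_pair.const_both[OF other rank])
  obtain h k where hk: "admissible q1 q2 h k" "\<forall>t\<in>{a<..<b}. h (q1 t) \<noteq> 0"
      "\<forall>t\<in>{0..1} - {a<..b}. h (q1 t) = 0"
    using bulk_perturbation[OF const(1)] by blast
  obtain h' k' where hk': "admissible q1 q2 h' k'" "\<forall>t\<in>{a'<..<b'}. h' (q1 t) \<noteq> 0"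
      "\<forall>t\<in>{0..1} - {a'<..b'}. h' (q1 t) = 0"
    using gap_pair.bulk_perturbation[OF other const'(1)] by blast
  obtain s s' where ss: "s \<noteq> 0 \<or> s' \<noteq> 0" "\<forall>x. s * h (q1 x) + s' * h' (q1 x) = 0"
    using rank_oneD[OF rank hk(1) hk'(1)] by (elim exE conjE)
  have "h (q1 x) = 0"
    using bspec[OF hk(3), of x] x far by auto
  moreover have "h' (q1 x0) = 0"
    using bspec[OF hk'(3), of x0] x0 order by auto
  ultimately have "s * h (q1 x0) = 0" "s' * h' (q1 x) = 0"
    using spec[OF ss(2), of x0] spec[OF ss(2), of x] by simp_all
  moreover have "h (q1 x0) \<noteq> 0" "h' (q1 x) \<noteq> 0"
    using hk(2) hk'(2) x0 x' by auto
  ultimately show False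
    using ss(1) by simp
qed

section \<open>The two-step form\<close>

text \<open>With \<open>q2\<close> equal to a constant \<open>m\<close> on \<open>{c<..d}\<close>,
  the threshold of level \<open>1 - z\<close> is \<open>d\<close> for \<open>z \<le> 1 - m\<close>
  and \<open>c\<close> afterwards. The conjugate thus has the two values \<open>1 - d\<close> and
  \<open>1 - c\<close> on the gap.\<close>

lemma (in gap_pair) two_step_form:
  assumes rank: "rank_one q1 q2"
  shows "\<exists>l\<in>{0<..<1}. q1 a \<le> 1 - d \<and> 1 - c \<le> right_limit q1 b \<and>
    (\<forall>z\<in>{0..1} - {a<..b}. q1 z = conjugate q2 z) \<and>
    (\<forall>z\<in>{a<..b}. q1 z = l * (1 - c) + (1 - l) * (1 - d) \<and>
      conjugate q2 z = (if z \<le> (1 - l) * b + l * a then 1 - d else 1 - c))"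
proof -
  obtain w m where const: "\<forall>t\<in>{a<..<b}. q1 t = w" "\<forall>t\<in>{c<..<d}. q2 t = m"
    by (rule const_both[OF rank])
  have w: "q1 t = w" if "a < t" "t \<le> b" for t
    using bspec[OF const(1), of t] lc_const_right[OF lc1, of a b w] const(1) that order by (cases "t = b") auto
  have m: "q2 t = m" if "c < t" "t \<le> d" for t
    using bspec[OF const(2), of t] lc_const_right[OF lc2, of c d m] const(2) that order by (cases "t = d") auto
  have m_bounds: "1 - b < m" "m < 1 - a"
    using q2_inside[of "(c + d) / 2"] m[of "(c + d) / 2"] order by simp_all
  \<comment> \<open>Chosen so that \<open>(1 - l) * b + l * a\<close> is the jump point
    \<open>1 - m\<close>.\<close>
  define l where "l = (b - (1 - m)) / (b - a)"
  have l: "0 < l" "l < 1" and lb: "l * (b - a) = b - (1 - m)"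
    using m_bounds order by (simp_all add: l_def)
  \<comment> \<open>Reaching the slack at \<open>(b, d)\<close> from the zero \<open>(a, d)\<close>
    and from the zero \<open>(b, c)\<close> gives the relation between \<open>w\<close> and
    \<open>m\<close>.\<close>
  have "integral {a..b} (\<lambda>t. q1 t - (1 - d)) = (b - a) * (w - (1 - d))"
    using order const by (intro integral_eq_const integrable1) auto
  moreover have "integral {c..d} (\<lambda>t. q2 t - (1 - b)) = (d - c) * (m - (1 - b))"
    using order const by (intro integral_eq_const integrable2) auto
  ultimately have "(b - a) * (w - (1 - d)) = (d - c) * (m - (1 - b))"
    using slack_diff_x[of a b d] slack_diff_y[of c d b] corner order by simp
  also have "m - (1 - b) = l * (b - a)"
    using lb by simp
  finally have "(b - a) * (w - (1 - d)) = (b - a) * (l * (d - c))"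
    by (simp add: mult_ac)
  then have "w - (1 - d) = l * (d - c)"
    using order by simp
  then have w_eq: "w = l * (1 - c) + (1 - l) * (1 - d)"
    by (simp add: algebra_simps)
  have threshold: "(1 - l) * b + l * a = 1 - m"
    using lb by (simp add: algebra_simps)
  have conj: "conjugate q2 z = (if z \<le> 1 - m then 1 - d else 1 - c)" if z: "a < z" "z \<le> b" for z
  proof -
    have z1: "z \<le> 1"
      using z order by simp
    have low: "q2 t \<le> 1 - b" if "0 \<le> t" "t \<le> c" for t
      using q2_below that by simp
    have high: "1 - a \<le> q2 t" if "d < t" "t \<le> 1" for t
      using q2_above that by simp
    show ?thesis
    proof (cases "z \<le> 1 - m")
      case True
      have "conjugate q2 z = 1 - d"
      proof (rule conjugate_threshold[OF lc2 _ _ z1])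
        show "q2 t \<le> 1 - z" if "0 \<le> t" "t \<le> d" for t
          using low[of t] m[of t] that True z by (cases "t \<le> c") auto
        show "1 - z < q2 t" if "d < t" "t \<le> 1" for t
          using high[of t] that z by simp
      qed (use order in auto)
      then show ?thesis using True by simp
    next
      case False
      have "conjugate q2 z = 1 - c"
      proof (rule conjugate_threshold[OF lc2 _ _ z1])
        show "q2 t \<le> 1 - z" if "0 \<le> t" "t \<le> c" for t
          using low[of t] that z by simp
        show "1 - z < q2 t" if "c < t" "t \<le> 1" for t
          using high[of t] m[of t] that z False by (cases "t \<le> d") auto
      qed (use order in auto)
      then show ?thesis using False by simp
    qed
  qed
  have outside: "q1 z = conjugate q2 z" if z: "0 \<le> z" "z \<le> 1" "z \<le> a \<or> b < z" for z
  proof (cases "z = 0")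
    case True
    then show ?thesis
      using lc_0[OF lc1] conjugate_0[OF lc2] by simp
  next
    case False
    show ?thesis
    proof (rule eq_conjugate)
      fix u assume "u < z"
      \<comment> \<open>A midpoint that stays on the same side of the gap as \<open>z\<close>, so
        that a zero lies over it.\<close>
      define x where "x = (if z \<le> a then (max u 0 + z) / 2 else (max u b + z) / 2)"
      have x: "u < x" "x < z" "0 \<le> x" "x \<le> 1" "x \<le> a \<or> b \<le> x"
        using \<open>u < z\<close> z False order by (auto simp: x_def max_def)
      then show "\<exists>x\<ge>0. u < x \<and> x < z \<and> (\<exists>y\<in>{0..1}. slack q1 q2 x y = 0)"
        using gap_unique[OF rank x(3-5)] by blast
    qed (use z False in auto)
  qed
  have "1 - c \<le> right_limit q1 b"
    using order above by (intro right_limit_ge[OF lc1]) auto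
  moreover have "q1 a \<le> 1 - d"
    using below order by simp
  ultimately show ?thesis
    using l w w_eq conj outside threshold order
    by (intro bexI[of _ l]) auto
qed

lemma (in feasible_pair) rank_one_form:
  assumes rank: "rank_one q1 q2"
  shows "\<exists>zl\<in>{0..1}. \<exists>zu\<in>{0..1}. \<exists>\<gamma>l \<gamma>u. \<exists>l\<in>{0<..<1}.
    zl \<le> zu \<and> q1 zl \<le> \<gamma>l \<and> \<gamma>l \<le> \<gamma>u \<and> \<gamma>u \<le> right_limit q1 zu \<and>
    (\<forall>z\<in>{0..1} - {zl<..zu}. q1 z = conjugate q2 z) \<and>
    (\<forall>z\<in>{zl<..zu}. q1 z = l * \<gamma>u + (1 - l) * \<gamma>l \<and>
      conjugate q2 z = (if z \<le> (1 - l) * zu + l * zl then \<gamma>l else \<gamma>u))"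
proof (cases "\<exists>x0\<in>{0..1}. \<forall>y\<in>{0..1}. slack q1 q2 x0 y \<noteq> 0")
  case True
  then obtain x0 where "0 \<le> x0" "x0 \<le> 1" "\<forall>y\<in>{0..1}. slack q1 q2 x0 y \<noteq> 0"
    by auto
  then obtain a b c d where gap: "gap q1 q2 a b c d"
    using ex_gap by blast
  have gap_pair: "gap_pair q1 q2 a b c d"
    by unfold_locales (rule gap)
  have "a \<in> {0..1}" "b \<in> {0..1}" "a \<le> b" "1 - d \<le> 1 - c"
    using gap_pair.order[OF gap_pair] by auto
  then show ?thesis
    using gap_pair.two_step_form[OF gap_pair rank] by blast
next
  case False
  have eq: "q1 z = conjugate q2 z" if z: "0 < z" "z \<le> 1" for z
  proof (rule eq_conjugate[OF z])
    fix u assume "u < z"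
    define x where "x = (max u 0 + z) / 2"
    have x: "u < x" "x < z" "0 \<le> x" "x \<le> 1"
      using \<open>u < z\<close> z by (auto simp: x_def max_def)
    then have "\<exists>y\<in>{0..1}. slack q1 q2 x y = 0"
      using False by simp
    then show "\<exists>x\<ge>0. u < x \<and> x < z \<and> (\<exists>y\<in>{0..1}. slack q1 q2 x y = 0)"
      using x by blast
  qed
  have eq0: "q1 0 = conjugate q2 0"
    using lc_0[OF lc1] conjugate_0[OF lc2] by simp
  \<comment> \<open>Without a gap the exceptional interval is empty: both end points and both values
    are 0, and \<open>1/2\<close> serves as the weight.\<close>
  have "0 \<le> right_limit q1 0"
    using lc_range[OF lc1] by (intro right_limit_ge[OF lc1]) auto
  moreover have "\<forall>z\<in>{0..1} - {0<..0}. q1 z = conjugate q2 z"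
    using eq eq0 by (metis DiffD1 atLeastAtMost_iff order_le_less)
  ultimately show ?thesis
    using lc_0[OF lc1]
    by (intro bexI[of _ 0] exI[of _ 0] bexI[of _ "1/2"]) auto
qed

theorem proposition6:
  fixes \<psi>1 \<psi>2 q1 q2 :: "real \<Rightarrow> real" and \<eta> :: real
  assumes "essentially_bounded \<psi>1" and "essentially_bounded \<psi>2"
    and "(q1, q2) extreme_point_of feasible_set \<psi>1 \<psi>2 \<eta>"
  shows "\<exists>zl\<in>{0..1}. \<exists>zu\<in>{0..1}. \<exists>\<gamma>l \<gamma>u. \<exists>l\<in>{0<..<1}.
    zl \<le> zu \<and> q1 zl \<le> \<gamma>l \<and> \<gamma>l \<le> \<gamma>u \<and> \<gamma>u \<le> right_limit q1 zu \<and>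
    (\<forall>z\<in>{0..1} - {zl<..zu}. q1 z = conjugate q2 z) \<and>
    (\<forall>z\<in>{zl<..zu}. q1 z = l * \<gamma>u + (1 - l) * \<gamma>l \<and>
      conjugate q2 z = (if z \<le> (1 - l) * zu + l * zl then \<gamma>l else \<gamma>u))"
proof -
  have "feasible_pair q1 q2"
    using assms(3) by (simp add: extreme_point_of_def feasible_set_iff)
  then show ?thesis
    using feasible_pair.rank_one_form feasible_pair.extreme_rank_one assms by blast
qed

end
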